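(* Let $\mathbf{O}=\{X_1,\dots,X_n\}$ be finitely many random variables, each with finitely many states, with joint distribution $p$, and let $\mathbf{D}$ be a data set of $m$ i.i.d. samples from $p$. Suppose that $p$ satisfies the composition property. Let $S$ be any locally consistent (and score equivalent) scoring criterion. Then, in the limit of large $m$, the greedy equivalence search algorithm GES run with $S$ on $\mathbf{D}$ outputs an equivalence class of DAGs that is inclusion optimal for $p$; that is, the probability that the output of GES is inclusion optimal for $p$ tends to $1$ as $m\to\infty$.
   Context: DAG models. A DAG $\mathcal{G}$ (directed acyclic graph) has node set $\mathbf{O}$; $\mathbf{Pa}_i^{\mathcal{G}}$ is the set of parents of $X_i$. $\mathcal{G}$ includes a distribution $p$ on $\mathbf{O}$ if $p$ factors as $p(x_1,\dots,x_n)=\prod_{i=1}^n p_i(x_i\mid \mathbf{pa}_i^{\mathcal{G}})$ for some (unrestricted, full-table) conditional distributions $p_i$; equivalently, in $p$ each $X_i$ is independent of its non-descendants given its parents. The independence constraints of $\mathcal{G}$ are those that hold in every distribution included in $\mathcal{G}$ (equivalently, given by d-separation). Write $\mathcal{G}\le\mathcal{H}$ if every distribution included in $\mathcal{G}$ is included in $\mathcal{H}$ (equivalently, every independence constraint of $\mathcal{H}$ is one of $\mathcal{G}$); $\mathcal{G}\approx\mathcal{H}$ if $\mathcal{G}\le\mathcal{H}$ and $\mathcal{H}\le\mathcal{G}$; $\mathcal{G}<\mathcal{H}$ if $\mathcal{G}\le\mathcal{H}$ and $\mathcal{G}\not\approx\mathcal{H}$. $\mathcal{E}(\mathcal{G})$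 denotes the $\approx$-equivalence class of $\mathcal{G}$; all DAGs in a class have the same number of edges, and inclusion notions extend to classes via representatives. Inclusion optimality. $\mathcal{G}$ (or its class) is inclusion optimal for $p$ if $\mathcal{G}$ includes $p$ and there is no DAG $\mathcal{G}'$ with $\mathcal{G}'<\mathcal{G}$ that includes $p$. Composition property of $p$: for every variable $X\in\mathbf{O}$ and disjoint sets $\mathbf{Y},\mathbf{Z}\subseteq\mathbf{O}\setminus\{X\}$, if $X$ is not independent of $\mathbf{Y}$ given $\mathbf{Z}$ in $p$, then there is $Y\in\mathbf{Y}$ such that $X$ is not independent of $Y$ given $\mathbf{Z}$ in $p$. Scores. A scoring criterion is a real-valued function $S(\mathcal{G},\mathbf{D})$ of a DAG and a data set. It is score equivalent if $\mathcal{G}\approx\mathcal{H}$ implies $S(\mathcal{G},\mathbf{D})=S(\mathcal{H},\mathbf{D})$; the score of an equivalence class is then the common score of its members. "In the limit of large $m$" a property holds if it holds with probability tending to $1$ as $m\to\infty$. $S$ is locally consistent if, for data $\mathbf{D}$ of $m$ i.i.d. samples from a distribution $p$, and for every DAG $\mathcal{G}$ and every DAG $\mathcal{G}'$ obtained from $\mathcal{G}$ by adding an edge $X_j\to X_i$, in the limit of large $m$: (1) if $X_j$ is not independent of $X_i$ given $\mathbf{Pa}_i^{\mathcal{G}}$ in $p$, then $S(\mathcal{G}',\mathbf{D})>S(\mathcal{G},\mathbf{D})$; (2) if $X_j$ is independent of $X_i$ given $\mathbf{Pa}_i^{\mathcal{G}}$ in $p$, then $S(\mathcal{G}',\mathbf{D})<S(\mathcal{G},\mathbf{D})$.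 Search. States are equivalence classes of DAGs on $\mathbf{O}$. $\mathcal{E}(\mathcal{G})$ and $\mathcal{E}(\mathcal{G}')$ are adjacent if ($\mathcal{G}\le\mathcal{G}'$ or $\mathcal{G}'\le\mathcal{G}$) and the numbers of edges of $\mathcal{G}$ and $\mathcal{G}'$ differ by exactly one. A move from $\mathcal{E}(\mathcal{G})$ to an adjacent $\mathcal{E}(\mathcal{G}')$ is forward if $\mathcal{G}\le\mathcal{G}'$, and backward otherwise. A greedy search repeatedly moves to a highest-scoring state among those reachable by one allowed move, provided its score is strictly greater than the current one, and stops at a local maximum (no allowed move increases the score). FES is greedy search allowing only forward moves; BES is greedy search allowing only backward moves. GES runs FES from the class of the DAG with no edges, then runs BES from the resulting local maximum, and outputs the final state of BES. *)

theory Defs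
  imports "HOL-Probability.Probability"
begin

section \<open>Discrete distributions on finitely many variables\<close>

text \<open>
  The variables are the elements of a finite type \<open>'v\<close>. Variable \<open>i\<close> takes its values in the
  finite set \<open>St i\<close>, so different variables may have different numbers of states.
\<close>

definition finite_states :: "('v \<Rightarrow> 's set) \<Rightarrow> bool" where
  "finite_states St \<longleftrightarrow> (\<forall>i. finite (St i))"

definition configs :: "('v \<Rightarrow> 's set) \<Rightarrow> ('v \<Rightarrow> 's) set" where
  "configs St = {x. \<forall>i. x i \<in> St i}"

definition distribution_on :: "('v \<Rightarrow> 's set) \<Rightarrow> ('v \<Rightarrow> 's) pmf \<Rightarrow> bool" where
  "distribution_on St p \<longleftrightarrow> set_pmf p \<subseteq> configs St"

definition agree_on :: "'v set \<Rightarrow> ('v \<Rightarrow> 's) \<Rightarrow> ('v \<Rightarrow> 's) \<Rightarrow> bool" where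
  "agree_on A x y \<longleftrightarrow> (\<forall>i\<in>A. y i = x i)"

text \<open>
  Conditional independence of \<open>A\<close> and \<open>B\<close> given \<open>C\<close>. Values \<open>x\<close> on \<open>C\<close> of probability zero
  impose no condition, because then all three conditional probabilities are \<open>0\<close> by
  \<open>a / 0 = 0\<close>.
\<close>

definition cond_indep :: "('v \<Rightarrow> 's) pmf \<Rightarrow> 'v set \<Rightarrow> 'v set \<Rightarrow> 'v set \<Rightarrow> bool" where
  "cond_indep p A B C \<longleftrightarrow>
     (\<forall>x. \<P>(y in measure_pmf p. agree_on A x y \<and> agree_on B x y \<bar> agree_on C x y) =
          \<P>(y in measure_pmf p. agree_on A x y \<bar> agree_on C x y) *
          \<P>(y in measure_pmf p. agree_on B x y \<bar> agree_on C x y))"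

definition composition_property :: "('v \<Rightarrow> 's) pmf \<Rightarrow> bool" where
  "composition_property p \<longleftrightarrow>
     (\<forall>X Y Z. X \<notin> Y \<longrightarrow> X \<notin> Z \<longrightarrow> Y \<inter> Z = {} \<longrightarrow>
        \<not> cond_indep p {X} Y Z \<longrightarrow> (\<exists>y\<in>Y. \<not> cond_indep p {X} {y} Z))"


section \<open>DAG models\<close>

text \<open>
  A DAG on the variables is its set \<open>G\<close> of edges with \<open>acyclic G\<close>; the pair \<open>(j, i)\<close> is the
  edge from \<open>j\<close> to \<open>i\<close>.
\<close>

type_synonym 'v graph = "('v \<times> 'v) set"

definition parents :: "'v graph \<Rightarrow> 'v \<Rightarrow> 'v set" where
  "parents G i = {j. (j, i) \<in> G}"

text \<open>
  \<open>K i\<close> is the conditional distribution of variable \<open>i\<close>, a function of the configuration of its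
  parents only. State spaces need not be mentioned: as the equation holds for every \<open>x\<close>, the
  distribution \<open>K i c\<close> lives on the states of \<open>i\<close> for every parent configuration \<open>c\<close> of positive
  probability, and the other parent configurations are irrelevant.
\<close>

definition dag_includes :: "'v::finite graph \<Rightarrow> ('v \<Rightarrow> 's) pmf \<Rightarrow> bool" where
  "dag_includes G p \<longleftrightarrow>
     (\<exists>K :: 'v \<Rightarrow> ('v \<Rightarrow> 's) \<Rightarrow> 's pmf.
        \<forall>x. pmf p x = (\<Prod>i\<in>UNIV. pmf (K i (restrict x (parents G i))) (x i)))"

text \<open>
  Inclusion of models is a relation between graphs: it refers to all distributions of the
  variables with arbitrary finite state spaces, whose elements may be taken to be natural
  numbers. Fixing the state spaces instead would give the same relation if each variable has
  at least two states, but a variable with a single state would make edges at it invisible,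
  and the correspondence with d-separation would fail.
\<close>

definition dag_le :: "'v::finite graph \<Rightarrow> 'v graph \<Rightarrow> bool" where
  "dag_le G H \<longleftrightarrow>
     (\<forall>(St :: 'v \<Rightarrow> nat set) p. finite_states St \<longrightarrow> distribution_on St p \<longrightarrow>
        dag_includes G p \<longrightarrow> dag_includes H p)"

definition dag_equiv :: "'v::finite graph \<Rightarrow> 'v graph \<Rightarrow> bool" where
  "dag_equiv G H \<longleftrightarrow> dag_le G H \<and> dag_le H G"

definition dag_less :: "'v::finite graph \<Rightarrow> 'v graph \<Rightarrow> bool" where
  "dag_less G H \<longleftrightarrow> dag_le G H \<and> \<not> dag_equiv G H"

definition dag_rel :: "('v::finite graph \<times> 'v graph) set" where
  "dag_rel = {(G, H). acyclic G \<and> acyclic H \<and> dag_equiv G H}"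

lemma equiv_dag_rel: "equiv {G. acyclic G} (dag_rel :: ('v::finite graph \<times> 'v graph) set)"
proof (rule equivI)
  have le_refl: "dag_le G G" for G :: "'v graph"
    unfolding dag_le_def by blast
  have le_trans: "dag_le G K" if "dag_le G H" "dag_le H K" for G H K :: "'v graph"
    using that unfolding dag_le_def by blast
  show "dag_rel \<subseteq> {G. acyclic G} \<times> {G. acyclic (G :: 'v graph)}"
    unfolding dag_rel_def by blast
  show "refl_on {G. acyclic (G :: 'v graph)} dag_rel"
    by (rule refl_onI) (simp add: dag_rel_def dag_equiv_def le_refl)
  show "sym (dag_rel :: ('v graph \<times> 'v graph) set)"
    unfolding sym_def dag_rel_def dag_equiv_def by blast
  show "trans (dag_rel :: ('v graph \<times> 'v graph) set)"
    unfolding trans_def dag_rel_def dag_equiv_def using le_trans by blast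
qed

definition dag_classes :: "'v::finite graph set set" where
  "dag_classes = {G. acyclic G} // dag_rel"

definition dag_class :: "'v::finite graph \<Rightarrow> 'v graph set" where
  "dag_class G = dag_rel `` {G}"

definition inclusion_optimal :: "('v \<Rightarrow> 's) pmf \<Rightarrow> 'v::finite graph \<Rightarrow> bool" where
  "inclusion_optimal p G \<longleftrightarrow>
     dag_includes G p \<and> \<not> (\<exists>G'. acyclic G' \<and> dag_less G' G \<and> dag_includes G' p)"

definition class_inclusion_optimal :: "('v \<Rightarrow> 's) pmf \<Rightarrow> 'v::finite graph set \<Rightarrow> bool" where
  "class_inclusion_optimal p E \<longleftrightarrow> E \<in> dag_classes \<and> (\<forall>G\<in>E. inclusion_optimal p G)"


section \<open>Scoring criteria\<close>

text \<open>A data set is the list of its records.\<close>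

type_synonym ('v, 's) score = "'v graph \<Rightarrow> ('v \<Rightarrow> 's) list \<Rightarrow> real"

definition score_equivalent :: "('v \<Rightarrow> 's set) \<Rightarrow> ('v::finite, 's) score \<Rightarrow> bool" where
  "score_equivalent St S \<longleftrightarrow>
     (\<forall>G H D. acyclic G \<longrightarrow> acyclic H \<longrightarrow> dag_equiv G H \<longrightarrow> set D \<subseteq> configs St \<longrightarrow> S G D = S H D)"

definition class_score ::
    "('v::finite, 's) score \<Rightarrow> ('v \<Rightarrow> 's) list \<Rightarrow> 'v graph set \<Rightarrow> real" where
  "class_score S D E = the_elem ((\<lambda>G. S G D) ` E)"

text \<open>
  The property \<open>P\<close> of data sets holds in the limit of large \<open>m\<close>, for \<open>m\<close> independent samples
  from \<open>p\<close>.
\<close>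

definition holds_in_limit :: "('v \<Rightarrow> 's) pmf \<Rightarrow> (('v \<Rightarrow> 's) list \<Rightarrow> bool) \<Rightarrow> bool" where
  "holds_in_limit p P \<longleftrightarrow>
     (\<lambda>m. \<P>(D in measure_pmf (replicate_pmf m p). P D)) \<longlonglongrightarrow> 1"

definition locally_consistent :: "('v \<Rightarrow> 's set) \<Rightarrow> ('v::finite, 's) score \<Rightarrow> bool" where
  "locally_consistent St S \<longleftrightarrow>
     (\<forall>p G i j. distribution_on St p \<longrightarrow> acyclic G \<longrightarrow> (j, i) \<notin> G \<longrightarrow>
        acyclic (insert (j, i) G) \<longrightarrow>
        (\<not> cond_indep p {j} {i} (parents G i) \<longrightarrow>
           holds_in_limit p (\<lambda>D. S (insert (j, i) G) D > S G D)) \<and>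
        (cond_indep p {j} {i} (parents G i) \<longrightarrow>
           holds_in_limit p (\<lambda>D. S (insert (j, i) G) D < S G D)))"


section \<open>Greedy equivalence search\<close>

definition class_le :: "'v::finite graph set \<Rightarrow> 'v graph set \<Rightarrow> bool" where
  "class_le E F \<longleftrightarrow> (\<exists>G\<in>E. \<exists>H\<in>F. dag_le G H)"

definition adjacent_classes :: "'v::finite graph set \<Rightarrow> 'v graph set \<Rightarrow> bool" where
  "adjacent_classes E F \<longleftrightarrow> E \<in> dag_classes \<and> F \<in> dag_classes \<and>
     (\<exists>G\<in>E. \<exists>H\<in>F. (dag_le G H \<or> dag_le H G) \<and>
        (card H = card G + 1 \<or> card G = card H + 1))"

definition forward_move :: "'v::finite graph set \<Rightarrow> 'v graph set \<Rightarrow> bool" where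
  "forward_move E F \<longleftrightarrow> adjacent_classes E F \<and> class_le E F"

definition backward_move :: "'v::finite graph set \<Rightarrow> 'v graph set \<Rightarrow> bool" where
  "backward_move E F \<longleftrightarrow> adjacent_classes E F \<and> \<not> class_le E F"

text \<open>
  Several states may attain the highest score among the reachable ones, so greedy search is a
  relation, which covers every way of breaking ties.
\<close>

definition greedy_step :: "('q \<Rightarrow> 'q \<Rightarrow> bool) \<Rightarrow> ('q \<Rightarrow> real) \<Rightarrow> 'q \<Rightarrow> 'q \<Rightarrow> bool" where
  "greedy_step move sc E F \<longleftrightarrow>
     move E F \<and> sc F > sc E \<and> (\<forall>F'. move E F' \<longrightarrow> sc F' \<le> sc F)"

definition local_maximum :: "('q \<Rightarrow> 'q \<Rightarrow> bool) \<Rightarrow> ('q \<Rightarrow> real) \<Rightarrow> 'q \<Rightarrow> bool" where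
  "local_maximum move sc E \<longleftrightarrow> \<not> (\<exists>F. move E F \<and> sc F > sc E)"

definition greedy_search :: "('q \<Rightarrow> 'q \<Rightarrow> bool) \<Rightarrow> ('q \<Rightarrow> real) \<Rightarrow> 'q \<Rightarrow> 'q \<Rightarrow> bool" where
  "greedy_search move sc E F \<longleftrightarrow> (greedy_step move sc)\<^sup>*\<^sup>* E F \<and> local_maximum move sc F"

definition GES_outputs ::
    "('v::finite, 's) score \<Rightarrow> ('v \<Rightarrow> 's) list \<Rightarrow> 'v graph set set" where
  "GES_outputs S D =
     {F. \<exists>E. greedy_search forward_move (class_score S D) (dag_class {}) E \<and>
             greedy_search backward_move (class_score S D) E F}"

end

theory Submission
  imports Defs
begin

text \<open>
  The core is the theorem of Meek and Chickering: if \<open>dag_le G H\<close>, then \<open>G\<close> is transformed into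
  \<open>H\<close> by edge additions and reversals of covered edges, each of which enlarges the model. The
  inclusion first yields, for every vertex \<open>w\<close> of a topological order of \<open>H\<close>, that in the
  moral graph of the \<open>G\<close>-ancestors of \<open>w\<close> and its predecessors the parents of \<open>w\<close> in \<open>H\<close>
  separate \<open>w\<close> from the other predecessors; otherwise a three-state distribution on \<open>G\<close>, in
  which the vertices of a connecting component agree unless a failure is visible among the
  predecessors, would violate \<open>H\<close>. The vertices are then made to agree with \<open>H\<close> from the last
  to the first. To make the current vertex \<open>y\<close> a sink, let \<open>d\<close> be the \<open>H\<close>-first proper
  \<open>G\<close>-descendant of \<open>y\<close> and \<open>z\<close> a \<open>G\<close>-minimal child of \<open>y\<close> among those with \<open>d\<close> as descendant
  (or equal to \<open>d\<close>); covering \<open>y \<rightarrow> z\<close> by additions and reversing it preserves all separations,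
  because \<open>y\<close> is an ancestor of an initial segment only if \<open>z\<close> is.

  For a data set on which all the finitely many inequalities of local consistency hold, a
  local maximum of the forward phase includes \<open>p\<close> by the composition property, and the last
  addition in a chain of operations shows both that backward moves which increase the score
  keep \<open>p\<close> included and that a class including \<open>p\<close> which is not optimal can be improved.
\<close>

section \<open>Marginals and the ordered Markov property\<close>

text \<open>\<open>x\<close> is a total configuration of which only the coordinates in
  \<open>A\<close> count, so partial configurations need no type of their own.\<close>

definition marg :: "('v \<Rightarrow> 's) pmf \<Rightarrow> 'v set \<Rightarrow> ('v \<Rightarrow> 's) \<Rightarrow> real" where
  "marg p A x = measure (measure_pmf p) {y. agree_on A x y}"

lemma marg_nonneg: "marg p A x \<ge> 0"
  unfolding marg_def by simp

lemma marg_cong: "(\<And>i. i \<in> A \<Longrightarrow> x i = y i) \<Longrightarrow> marg p A x = marg p A y"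
  unfolding marg_def agree_on_def by (metis (no_types, lifting))

lemma marg_upd: "b \<notin> A \<Longrightarrow> marg p A (x(b := v)) = marg p A x"
  by (rule marg_cong) auto

lemma marg_empty: "marg p {} x = 1"
  unfolding marg_def agree_on_def by simp

lemma marg_UNIV: "marg p UNIV x = pmf p x"
proof -
  have "{y. agree_on UNIV x y} = {x}"
    unfolding agree_on_def by auto
  then show ?thesis
    unfolding marg_def by (simp add: measure_pmf_single)
qed

lemma marg_mono: "A \<subseteq> B \<Longrightarrow> marg p B x \<le> marg p A x"
  unfolding marg_def agree_on_def by (rule measure_pmf.finite_measure_mono) auto

lemma marg_eq_0_mono: "marg p A x = 0 \<Longrightarrow> A \<subseteq> B \<Longrightarrow> marg p B x = 0"
  using marg_mono[of A B p x] marg_nonneg[of p B x] by simp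

lemma marg_pos_iff: "marg p A x \<noteq> 0 \<longleftrightarrow> (\<exists>y\<in>set_pmf p. agree_on A x y)"
  unfolding marg_def by (auto simp: measure_pmf_zero_iff)

text \<open>Conditioned on \<open>E\<close>, the values of \<open>f\<close> have a
  \<open>pmf\<close>, whose masses add up to 1. The integral over \<open>count_space\<close> plays
  the role of a sum, so \<open>f\<close> may take infinitely many values.\<close>

lemma measure_disintegrate:
  "measure (measure_pmf p) E
     = (\<integral>v. measure (measure_pmf p) (E \<inter> {y. f y = v}) \<partial>count_space UNIV)"
proof (cases "measure (measure_pmf p) E = 0")
  case True
  then have "measure (measure_pmf p) (E \<inter> {y. f y = v}) = 0" for v
    using measure_pmf.finite_measure_mono[of "E \<inter> {y. f y = v}" E p]
    by (simp add: measure_le_0_iff)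
  with True show ?thesis by simp
next
  case False
  then have ne: "set_pmf p \<inter> E \<noteq> {}"
    by (auto simp: measure_pmf_zero_iff)
  have m: "measure (measure_pmf (cond_pmf p E)) X
      = measure (measure_pmf p) (E \<inter> X) / measure (measure_pmf p) E" for X
    using False unfolding cond_pmf.rep_eq[OF ne]
    by (subst measure_uniform_measure) (auto simp: measure_pmf.emeasure_eq_measure)
  define q where "q = map_pmf f (cond_pmf p E)"
  have "pmf q v = measure (measure_pmf p) (E \<inter> {y. f y = v}) / measure (measure_pmf p) E" for v
    unfolding q_def pmf_map m by (simp add: vimage_def)
  moreover have "(\<integral>v. pmf q v \<partial>count_space UNIV) = 1"
    using integral_pmf[of UNIV q] by simp
  ultimately show ?thesis
    using False by simp
qed

lemma marg_disintegrate:
  assumes "b \<notin> B"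
  shows "marg p B x = (\<integral>v. marg p (insert b B) (x(b := v)) \<partial>count_space UNIV)"
proof -
  have "{y. agree_on B x y} \<inter> {y. y b = v} = {y. agree_on (insert b B) (x(b := v)) y}" for v
    using assms unfolding agree_on_def by auto
  then show ?thesis
    using measure_disintegrate[of p "{y. agree_on B x y}" "\<lambda>y. y b"]
    unfolding marg_def by simp
qed

text \<open>The equation is integrated over the value at \<open>b\<close>; \<alpha> and \<beta> do
  not see this coordinate.\<close>

lemma marg_sum_out:
  assumes b: "b \<notin> B" "b \<notin> B'"
    and \<alpha>: "\<And>v. \<alpha> (x(b := v)) = \<alpha> x" and \<beta>: "\<And>v. \<beta> (x(b := v)) = \<beta> x"
    and eq: "\<And>x. marg p (insert b B) x * \<alpha> x = marg p (insert b B') x * \<beta> x"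
  shows "marg p B x * \<alpha> x = marg p B' x * \<beta> x"
proof -
  have "marg p B x * \<alpha> x
      = (\<integral>v. marg p (insert b B) (x(b := v)) * \<alpha> (x(b := v)) \<partial>count_space UNIV)"
    by (simp add: marg_disintegrate[OF b(1)] \<alpha>)
  also have "\<dots> = (\<integral>v. marg p (insert b B') (x(b := v)) * \<beta> (x(b := v)) \<partial>count_space UNIV)"
    by (simp only: eq)
  also have "\<dots> = marg p B' x * \<beta> x"
    by (simp add: marg_disintegrate[OF b(2)] \<beta>)
  finally show ?thesis .
qed

lemma marg_sum_out_set:
  fixes D :: "'v::finite set"
  assumes D: "D \<inter> (B \<union> B') = {}"
    and \<alpha>: "\<And>b v x. b \<in> D \<Longrightarrow> \<alpha> (x(b := v)) = \<alpha> x"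
    and \<beta>: "\<And>b v x. b \<in> D \<Longrightarrow> \<beta> (x(b := v)) = \<beta> x"
    and eq: "\<And>x. marg p (D \<union> B) x * \<alpha> x = marg p (D \<union> B') x * \<beta> x"
  shows "marg p B x * \<alpha> x = marg p B' x * \<beta> x"
proof -
  have "finite D" by simp
  then have "\<forall>x. marg p B x * \<alpha> x = marg p B' x * \<beta> x"
    using D \<alpha> \<beta> eq
  proof (induction D rule: finite_induct)
    case (insert b D)
    have "marg p (D \<union> B) x * \<alpha> x = marg p (D \<union> B') x * \<beta> x" for x
      by (rule marg_sum_out[where b = b]) (use insert in auto)
    then show ?case using insert by auto
  qed simp
  then show ?thesis by blast
qed

text \<open>
  For \<open>C \<subseteq> B\<close> this is the independence of \<open>w\<close> and \<open>B - C\<close> given \<open>C\<close>, multiplied out so that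
  no division occurs.
\<close>

definition screens :: "('v \<Rightarrow> 's) pmf \<Rightarrow> 'v set \<Rightarrow> 'v set \<Rightarrow> 'v \<Rightarrow> bool" where
  "screens p C B w \<longleftrightarrow>
     (\<forall>x. marg p (insert w B) x * marg p C x = marg p (insert w C) x * marg p B x)"

lemma agree_on_Un: "agree_on (A \<union> B) x y \<longleftrightarrow> agree_on A x y \<and> agree_on B x y"
  unfolding agree_on_def by auto

text \<open>Denominators are cleared. Where \<open>marg p C x\<close> is zero, the larger marginals
  vanish with it and both forms hold.\<close>

lemma cond_indep_marg:
  "cond_indep p A B C \<longleftrightarrow>
     (\<forall>x. marg p (A \<union> B \<union> C) x * marg p C x = marg p (A \<union> C) x * marg p (B \<union> C) x)"
proof -
  have "(marg p (A \<union> B \<union> C) x / marg p C x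
        = marg p (A \<union> C) x / marg p C x * (marg p (B \<union> C) x / marg p C x))
      \<longleftrightarrow> marg p (A \<union> B \<union> C) x * marg p C x = marg p (A \<union> C) x * marg p (B \<union> C) x" for x
  proof (cases "marg p C x = 0")
    case True
    then show ?thesis
      using marg_eq_0_mono[OF True, of "A \<union> C"] marg_eq_0_mono[OF True, of "A \<union> B \<union> C"] by simp
  next
    case False
    then show ?thesis by (simp add: field_simps)
  qed
  then show ?thesis
    unfolding cond_indep_def cond_prob_def marg_def agree_on_Un by simp
qed

lemma cond_indep_screens:
  assumes "C \<subseteq> B"
  shows "cond_indep p {w} (B - C) C \<longleftrightarrow> screens p C B w"
proof -
  have "{w} \<union> (B - C) \<union> C = insert w B" "B - C \<union> C = B" "{w} \<union> C = insert w C"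
    using assms by auto
  then show ?thesis
    unfolding cond_indep_marg screens_def by simp
qed

lemma cond_indep_sym: "cond_indep p A B C \<longleftrightarrow> cond_indep p B A C"
  unfolding cond_indep_marg by (simp add: Un_commute mult.commute)

lemma cond_indep_single_screens:
  assumes "j \<notin> C"
  shows "cond_indep p {j} {w} C \<longleftrightarrow> screens p C (insert j C) w"
proof -
  have "insert j C - C = {j}" using assms by auto
  then show ?thesis
    using cond_indep_screens[of C "insert j C" p w] cond_indep_sym[of p "{j}" "{w}" C] by auto
qed

lemma screens_subset:
  fixes B :: "'v::finite set"
  assumes "screens p C B w" "C \<subseteq> B'" "B' \<subseteq> B" "w \<notin> B"
  shows "screens p C B' w"
proof -
  have "B - B' \<union> insert w B' = insert w B" "B - B' \<union> B' = B"
    using assms by auto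
  then have eq: "\<And>x. marg p (B - B' \<union> insert w B') x * marg p C x
      = marg p (B - B' \<union> B') x * marg p (insert w C) x"
    using assms(1) by (simp add: screens_def mult.commute)
  have "marg p (insert w B') x * marg p C x = marg p B' x * marg p (insert w C) x" for x
    by (rule marg_sum_out_set[OF _ _ _ eq]) (use assms(2-4) in \<open>auto intro!: marg_upd\<close>)
  then show ?thesis
    by (simp add: screens_def mult.commute)
qed

section \<open>Topological orders as injective ranks\<close>

definition topo :: "('v \<Rightarrow> nat) \<Rightarrow> 'v graph \<Rightarrow> bool" where
  "topo r G \<longleftrightarrow> inj r \<and> (\<forall>(a, b) \<in> G. r a < r b)"

definition preds :: "('v \<Rightarrow> nat) \<Rightarrow> 'v \<Rightarrow> 'v set" where
  "preds r w = {u. r u < r w}"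

lemma not_in_preds: "w \<notin> preds r w"
  by (simp add: preds_def)

lemma topoD: "topo r G \<Longrightarrow> (a, b) \<in> G \<Longrightarrow> r a < r b"
  by (auto simp: topo_def)

lemma parents_subset_preds: "topo r G \<Longrightarrow> parents G w \<subseteq> preds r w"
  by (auto simp: parents_def preds_def dest: topoD)

lemma acyclic_topo: "topo r G \<Longrightarrow> acyclic G"
  by (rule acyclic_subset[of "Wellfounded.measure r"])
    (auto dest: topoD intro: wf_acyclic)

text \<open>Ties of \<open>c\<close> are broken by an injective numbering below \<open>N\<close>: in
  \<open>c v * N + e v\<close> the value of \<open>c\<close> dominates.\<close>

lemma acyclic_rank:
  fixes G :: "'v::finite graph"
  assumes "\<And>a b. (a, b) \<in> G \<Longrightarrow> c a < (c b :: nat)"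
  obtains r where "topo r G" "\<And>a b. c a < c b \<Longrightarrow> r a < r b"
proof -
  obtain e :: "'v \<Rightarrow> nat" and N where e: "inj e" "\<And>v. e v < N"
    using finite_imp_inj_to_nat_seg[OF finite[of "UNIV :: 'v set"]] by (metis mem_Collect_eq rangeI)
  define r where "r v = c v * N + e v" for v
  have less: "r a < r b" if "c a < c b" for a b
  proof -
    have "r a < Suc (c a) * N" using e(2)[of a] by (simp add: r_def)
    also have "\<dots> \<le> c b * N" using that by (simp only: mult_le_mono1 Suc_le_eq)
    finally show ?thesis by (simp add: r_def)
  qed
  have "inj r"
  proof (rule injI)
    fix u v assume "r u = r v"
    then have "r u mod N = r v mod N" by simp
    then show "u = v" using e by (simp add: r_def inj_eq)
  qed
  then have "topo r G"
    using less assms by (auto simp: topo_def)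
  then show thesis using less that by blast
qed

text \<open>The number of proper ancestors grows strictly along every edge.\<close>

lemma acyclic_ex_topo:
  fixes G :: "'v::finite graph"
  assumes "acyclic G"
  obtains r where "topo r G"
proof -
  define c where "c v = card {u. (u, v) \<in> G\<^sup>+}" for v
  have "c a < c b" if "(a, b) \<in> G" for a b
    unfolding c_def
  proof (rule psubset_card_mono)
    have "a \<notin> {u. (u, a) \<in> G\<^sup>+}" "a \<in> {u. (u, b) \<in> G\<^sup>+}"
      using assms that by (auto simp: acyclic_def)
    then show "{u. (u, a) \<in> G\<^sup>+} \<subset> {u. (u, b) \<in> G\<^sup>+}"
      using that by (auto intro: trancl_into_trancl)
  qed simp
  then obtain r where "topo r G" by (rule acyclic_rank)
  then show thesis by (rule that)
qed

text \<open>Inductions along an order run over the bound \<open>k\<close>. Ranks may have gaps, so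
  raising the bound adds one vertex or none.\<close>

lemma less_Suc_rank:
  assumes "inj r"
  shows "(\<exists>w. r w = k \<and> {u. r u < Suc k} = insert w {u. r u < k} \<and> {u. r u < k} = preds r w)
    \<or> {u. r u < Suc k} = {u. r u < k}"
proof (cases "\<exists>w. r w = k")
  case True
  then obtain w where w: "r w = k" by blast
  then have "u = w" if "r u = k" for u using assms that by (auto dest: injD)
  with w show ?thesis by (auto simp: less_Suc_eq preds_def)
next
  case False
  then show ?thesis by (auto simp: less_Suc_eq)
qed

lemma rank_bounded:
  fixes r :: "'v::finite \<Rightarrow> nat"
  obtains N where "{u. r u < N} = UNIV"
proof
  have "r u \<le> Max (range r)" for u by simp
  then show "{u. r u < Suc (Max (range r))} = UNIV" by (auto simp: less_Suc_eq_le)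
qed

section \<open>Factorization and the ordered Markov property\<close>

lemma restrict_upd_parents: "b \<notin> A \<Longrightarrow> restrict (x(b := v)) A = restrict x A"
  by (auto simp: restrict_def)

text \<open>Integrating out the vertices from the last to the first leaves the product of the
  remaining factors. Hence the factor of \<open>w\<close> is its conditional probability given all
  predecessors; as it sees only the parents, the other predecessors can be summed out.\<close>

lemma dag_includes_screens:
  assumes r: "topo r G" and inc: "dag_includes G p"
  shows "screens p (parents G w) (preds r w) w"
proof -
  obtain K where K: "\<And>x. pmf p x = (\<Prod>i\<in>UNIV. pmf (K i (restrict x (parents G i))) (x i))"
    using inc unfolding dag_includes_def by blast
  define k where "k i x = pmf (K i (restrict x (parents G i))) (x i)" for i x
  have k_upd: "k i (x(b := v)) = k i x" if "b \<noteq> i" "b \<notin> parents G i" for i b x v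
    using that by (auto simp: k_def restrict_upd_parents)
  obtain N where N: "{u. r u < N} = UNIV" by (rule rank_bounded)
  have inj: "inj r" using r by (simp add: topo_def)
  have prefix: "\<forall>x. marg p {u. r u < n} x = (\<Prod>i | r i < n. k i x)" if "n \<le> N" for n
    using that
  proof (induction n rule: inc_induct)
    case base
    show ?case by (simp add: N marg_UNIV K k_def)
  next
    case (step n)
    from less_Suc_rank[OF inj, of n] show ?case
    proof (elim disjE exE conjE)
      fix w assume w: "r w = n" "{u. r u < Suc n} = insert w {u. r u < n}"
      let ?B = "{u. r u < n}"
      have wB: "w \<notin> ?B" using w by simp
      have pw: "w \<noteq> i" "w \<notin> parents G i" if "i \<in> ?B" for i
        using that w(1) r by (auto simp: parents_def dest: topoD)
      have wp: "w \<notin> parents G w"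
        using r by (auto simp: parents_def dest: topoD)
      show ?case
      proof
        fix x
        have "marg p (insert w ?B) (x(w := v))
            = pmf (K w (restrict x (parents G w))) v * (\<Prod>i\<in>?B. k i x)" for v
        proof -
          have "marg p (insert w ?B) (x(w := v)) = k w (x(w := v)) * (\<Prod>i\<in>?B. k i (x(w := v)))"
            using step.IH w(2) wB by simp
          moreover have "(\<Prod>i\<in>?B. k i (x(w := v))) = (\<Prod>i\<in>?B. k i x)"
            by (rule prod.cong) (use k_upd pw in auto)
          ultimately show ?thesis
            using wp by (simp add: k_def restrict_upd_parents)
        qed
        then show "marg p ?B x = (\<Prod>i\<in>?B. k i x)"
          using integral_pmf[of UNIV "K w (restrict x (parents G w))"]
          by (simp add: marg_disintegrate[OF wB])
      qed
    next
      assume "{u. r u < Suc n} = {u. r u < n}"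
      then show ?case using step.IH by simp
    qed
  qed
  let ?B = "preds r w" and ?C = "parents G w"
  have CB: "?C \<subseteq> ?B" by (rule parents_subset_preds[OF r])
  have rN: "r w < N" using N by blast
  have full: "marg p (insert w ?B) x = marg p ?B x * k w x" for x
  proof -
    have "{u. r u < Suc (r w)} = insert w ?B"
      using inj by (auto simp: preds_def less_Suc_eq dest: injD)
    moreover have "{u. r u < r w} = ?B" by (simp add: preds_def)
    ultimately show ?thesis
      using prefix[of "r w"] prefix[of "Suc (r w)"] rN not_in_preds[of w r] by simp
  qed
  have "?B - ?C \<union> insert w ?C = insert w ?B" "?B - ?C \<union> ?C = ?B"
    using CB by auto
  then have eq: "\<And>x. marg p (?B - ?C \<union> insert w ?C) x * 1 = marg p (?B - ?C \<union> ?C) x * k w x"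
    by (simp add: full)
  have "marg p (insert w ?C) x * 1 = marg p ?C x * k w x" for x
    by (rule marg_sum_out_set[OF _ _ _ eq])
      (use not_in_preds[of w r] in \<open>auto intro: k_upd\<close>)
  then show ?thesis
    by (simp add: screens_def full)
qed

text \<open>The factors are the conditional probabilities of \<open>p\<close> itself: in the chain
  rule along \<open>r\<close>, screening reduces conditioning on all predecessors to conditioning on
  the parents.\<close>

lemma screens_dag_includes:
  assumes r: "topo r G" and s: "\<And>w. screens p (parents G w) (preds r w) w"
  shows "dag_includes G p"
proof -
  \<comment> \<open>On null parent configurations the choice is arbitrary: the marginal of the
    predecessors, and with it the product of the earlier factors, is already zero there.\<close>
  define K where "K i c = (if marg p (parents G i) c = 0 then return_pmf undefined
      else map_pmf (\<lambda>y. y i) (cond_pmf p {y. agree_on (parents G i) c y}))" for i c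
  define k where "k i x = pmf (K i (restrict x (parents G i))) (x i)" for i x
  have k: "k i x * marg p (parents G i) x = marg p (insert i (parents G i)) x" for i x
  proof (cases "marg p (parents G i) x = 0")
    case True
    then show ?thesis
      using marg_eq_0_mono[OF True, of "insert i (parents G i)"] by auto
  next
    case False
    let ?E = "{y. agree_on (parents G i) x y}"
    have ne: "set_pmf p \<inter> ?E \<noteq> {}"
      using False by (auto simp: marg_pos_iff)
    have "agree_on (parents G i) (restrict x (parents G i)) = agree_on (parents G i) x"
      by (auto simp: agree_on_def)
    moreover have "marg p (parents G i) (restrict x (parents G i)) = marg p (parents G i) x"
      by (rule marg_cong) simp
    ultimately have "k i x = measure (measure_pmf (cond_pmf p ?E)) {y. y i = x i}"
      using False by (simp add: k_def K_def pmf_map vimage_def)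
    also have "\<dots> = measure (measure_pmf p) (?E \<inter> {y. y i = x i}) / measure (measure_pmf p) ?E"
      using False unfolding cond_pmf.rep_eq[OF ne]
      by (subst measure_uniform_measure)
        (auto simp: measure_pmf.emeasure_eq_measure marg_def)
    also have "?E \<inter> {y. y i = x i} = {y. agree_on (insert i (parents G i)) x y}"
      by (auto simp: agree_on_def)
    finally show ?thesis
      using False by (simp add: marg_def)
  qed
  have inj: "inj r" using r by (simp add: topo_def)
  have prefix: "marg p {u. r u < n} x = (\<Prod>i | r i < n. k i x)" for n x
  proof (induction n)
    case 0
    show ?case by (simp add: marg_empty)
  next
    case (Suc n)
    from less_Suc_rank[OF inj, of n] show ?case
    proof (elim disjE exE conjE)
      fix w assume w: "r w = n" "{u. r u < Suc n} = insert w {u. r u < n}"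
        "{u. r u < n} = preds r w"
      let ?B = "preds r w"
      have "marg p (insert w ?B) x = marg p ?B x * k w x"
      proof (cases "marg p (parents G w) x = 0")
        case True
        then have "marg p ?B x = 0" "marg p (insert w ?B) x = 0"
          using marg_eq_0_mono[OF True] parents_subset_preds[OF r, of w] by (meson subset_insertI2)+
        then show ?thesis by simp
      next
        case False
        have "marg p (insert w ?B) x * marg p (parents G w) x
            = marg p ?B x * k w x * marg p (parents G w) x"
          using s[of w] k[of w x] by (simp add: screens_def algebra_simps)
        with False show ?thesis by simp
      qed
      then show ?case
        using Suc.IH w not_in_preds[of w r] by simp
    qed (use Suc.IH in simp)
  qed
  obtain N where N: "{u. r u < N} = UNIV" by (rule rank_bounded)
  then have "pmf p x = (\<Prod>i\<in>UNIV. k i x)" for x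
    using prefix[of N x] by (simp add: marg_UNIV)
  then show ?thesis
    unfolding dag_includes_def k_def by blast
qed

text \<open>The variables are sampled one after another along \<open>r\<close>.\<close>

lemma ex_joint_pmf:
  fixes G :: "'v::finite graph"
  assumes r: "topo r G"
  obtains p where "\<And>x. pmf p x = (\<Prod>i\<in>UNIV. pmf (K i (restrict x (parents G i))) (x i))"
proof -
  define k where "k i x = pmf (K i (restrict x (parents G i))) (x i)" for i x
  have inj: "inj r" using r by (simp add: topo_def)
  have prefix: "\<exists>p. \<forall>x. marg p {u. r u < n} x = (\<Prod>i | r i < n. k i x)" for n
  proof (induction n)
    case 0
    show ?case by (simp add: marg_empty)
  next
    case (Suc n)
    then obtain p where p: "\<And>x. marg p {u. r u < n} x = (\<Prod>i | r i < n. k i x)" by blast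
    from less_Suc_rank[OF inj, of n] show ?case
    proof (elim disjE exE conjE)
      fix w assume w: "r w = n" "{u. r u < Suc n} = insert w {u. r u < n}"
        "{u. r u < n} = preds r w"
      let ?B = "preds r w"
      \<comment> \<open>A draw from \<open>p\<close> has its coordinate \<open>w\<close> overwritten
        according to the kernel; nothing is claimed yet about coordinates of higher rank.\<close>
      define q where
        "q = bind_pmf p (\<lambda>y. map_pmf (\<lambda>v. y(w := v)) (K w (restrict y (parents G w))))"
      have "marg q (insert w ?B) x = marg p ?B x * k w x" for x
      proof -
        have *: "emeasure (measure_pmf (map_pmf (\<lambda>v. y(w := v)) (K w (restrict y (parents G w)))))
              {z. agree_on (insert w ?B) x z}
            = ennreal (k w x) * indicator {y. agree_on ?B x y} y" for y
        proof (cases "agree_on ?B x y")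
          case True
          then have "(\<lambda>v. y(w := v)) -` {z. agree_on (insert w ?B) x z} = {x w}"
            using not_in_preds[of w r] by (auto simp: agree_on_def)
          moreover have "restrict y (parents G w) = restrict x (parents G w)"
            using True parents_subset_preds[OF r, of w] by (fastforce simp: agree_on_def restrict_def)
          ultimately show ?thesis
            using True by (simp add: emeasure_pmf_single k_def)
        next
          case False
          then have "(\<lambda>v. y(w := v)) -` {z. agree_on (insert w ?B) x z} = {}"
            using not_in_preds[of w r] by (auto simp: agree_on_def)
          with False show ?thesis by simp
        qed
        have "ennreal (marg q (insert w ?B) x)
            = (\<integral>\<^sup>+y. ennreal (k w x) * indicator {y. agree_on ?B x y} y \<partial>measure_pmf p)"
          unfolding marg_def measure_pmf.emeasure_eq_measure[symmetric] q_def emeasure_bind_pmf *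
          by simp
        also have "\<dots> = ennreal (k w x * marg p ?B x)"
          by (simp add: nn_integral_cmult measure_pmf.emeasure_eq_measure marg_def ennreal_mult k_def)
        finally show ?thesis
          by (simp add: marg_nonneg k_def mult.commute)
      qed
      then show ?case
        using w p not_in_preds[of w r] by (intro exI[of _ q]) simp
    qed (use p in auto)
  qed
  obtain N where N: "{u. r u < N} = UNIV" by (rule rank_bounded)
  with prefix[of N] show thesis
    using that by (auto simp: marg_UNIV k_def)
qed

section \<open>Edge additions and covered edge reversals\<close>

definition covered :: "'v graph \<Rightarrow> 'v \<Rightarrow> 'v \<Rightarrow> bool" where
  "covered G y z \<longleftrightarrow> (y, z) \<in> G \<and> parents G z = insert y (parents G y)"

definition reverse_edge :: "'v graph \<Rightarrow> 'v \<Rightarrow> 'v \<Rightarrow> 'v graph" where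
  "reverse_edge G y z = insert (z, y) (G - {(y, z)})"

inductive edge_op :: "'v graph \<Rightarrow> 'v graph \<Rightarrow> bool" where
  add: "(j, i) \<notin> G \<Longrightarrow> acyclic (insert (j, i) G) \<Longrightarrow> edge_op G (insert (j, i) G)"
| reverse: "acyclic G \<Longrightarrow> covered G y z \<Longrightarrow> edge_op G (reverse_edge G y z)"

section \<open>Parents and orders after a covered reversal\<close>

lemma graph_eq_parents: "(\<And>v. parents G v = parents H v) \<Longrightarrow> G = H"
  by (auto simp: parents_def set_eq_iff)

lemma parents_insert: "parents (insert (j, i) G) w = (if w = i then insert j (parents G i) else parents G w)"
  by (auto simp: parents_def)

lemma acyclic_no_loop: "acyclic G \<Longrightarrow> (v, v) \<notin> G"
  by (auto simp: acyclic_def)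

lemma acyclic_no_2cycle: "acyclic G \<Longrightarrow> (u, v) \<in> G \<Longrightarrow> (v, u) \<notin> G"
  using trancl_into_trancl[OF r_into_trancl, of u v G u] by (auto simp: acyclic_def)

lemma
  assumes "acyclic G" "covered G y z"
  shows parents_reverse_edge:
      "parents (reverse_edge G y z) v
        = (if v = y then insert z (parents G y) else if v = z then parents G y else parents G v)"
    and covered_reverse_edge: "covered (reverse_edge G y z) z y"
    and reverse_reverse_edge: "reverse_edge (reverse_edge G y z) z y = G"
proof -
  have yz: "(y, z) \<in> G" "y \<noteq> z" "(z, y) \<notin> G" "(y, y) \<notin> G"
    using assms acyclic_no_loop[OF assms(1)] acyclic_no_2cycle[OF assms(1), of y z]
    by (auto simp: covered_def)
  show *: "parents (reverse_edge G y z) v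
      = (if v = y then insert z (parents G y) else if v = z then parents G y else parents G v)" for v
    using assms(2) yz by (auto simp: covered_def reverse_edge_def parents_def)
  show "covered (reverse_edge G y z) z y"
    using yz unfolding covered_def * by (simp add: reverse_edge_def)
  show "reverse_edge (reverse_edge G y z) z y = G"
    using yz by (auto simp: reverse_edge_def)
qed

text \<open>Both orders are obtained by moving \<open>z\<close> next to \<open>y\<close>.\<close>

lemma covered_orders:
  assumes r: "topo r G" and cov: "covered G y z"
  obtains r1 r2 B where "topo r1 G" "topo r2 (reverse_edge G y z)"
    "preds r1 y = B" "preds r1 z = insert y B" "preds r2 z = B" "preds r2 y = insert z B"
    "\<And>v. v \<noteq> y \<Longrightarrow> v \<noteq> z \<Longrightarrow> preds r1 v = preds r2 v" "y \<notin> B" "z \<notin> B" "y \<noteq> z"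
proof -
  \<comment> \<open>Doubling the ranks frees the odd place right after \<open>y\<close> for
    \<open>z\<close>; \<open>r2\<close> exchanges the two there. Since the edge is covered, all
    other parents of \<open>z\<close> already precede \<open>y\<close>.\<close>
  define r1 where "r1 v = (if v = z then 2 * r y + 1 else 2 * r v)" for v
  define r2 where "r2 v = (if v = z then 2 * r y else if v = y then 2 * r y + 1 else 2 * r v)" for v
  have inj: "r u = r v \<longleftrightarrow> u = v" for u v
    using r by (auto simp: topo_def dest: injD)
  have less: "r a < r b" if "(a, b) \<in> G" for a b
    using r that by (rule topoD)
  have yz: "(y, z) \<in> G" and pz: "\<And>a. (a, z) \<in> G \<longleftrightarrow> a = y \<or> (a, y) \<in> G"
    using cov by (auto simp: covered_def parents_def)
  have ryz: "r y < r z" using yz by (rule less)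
  have odd: "2 * a + 1 \<noteq> 2 * (b :: nat)" "2 * b \<noteq> 2 * a + 1" for a b by presburger+
  have "inj r1"
    using odd by (auto simp: inj_def r1_def inj split: if_splits)
  moreover have "r1 a < r1 b" if "(a, b) \<in> G" for a b
    using less[OF that] ryz that pz[of a] less[of a y] by (auto simp: r1_def)
  ultimately have t1: "topo r1 G" by (auto simp: topo_def)
  have "inj r2"
    using odd ryz by (auto simp: inj_def r2_def inj split: if_splits)
  moreover have "r2 a < r2 b" if "(a, b) \<in> reverse_edge G y z" for a b
  proof (cases "a = z \<and> b = y")
    case True
    then show ?thesis using ryz by (auto simp: r2_def)
  next
    case False
    with that have ab: "(a, b) \<in> G" "\<not> (a = y \<and> b = z)" by (auto simp: reverse_edge_def)
    show ?thesis
      using less[OF ab(1)] ryz ab pz[of a] less[of a y] by (auto simp: r2_def)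
  qed
  ultimately have t2: "topo r2 (reverse_edge G y z)" by (auto simp: topo_def)
  show thesis
  proof (rule that[OF t1 t2])
    show "preds r1 y = preds r y" "preds r1 z = insert y (preds r y)"
      "preds r2 z = preds r y" "preds r2 y = insert z (preds r y)"
      using ryz by (auto simp: preds_def r1_def r2_def less_Suc_eq_le order.order_iff_strict inj)
    show "preds r1 v = preds r2 v" if "v \<noteq> y" "v \<noteq> z" for v
      using that ryz inj[of y v] by (auto simp: preds_def r1_def r2_def)
    show "y \<notin> preds r y" "z \<notin> preds r y" "y \<noteq> z"
      using ryz by (auto simp: preds_def)
  qed
qed

lemma acyclic_reverse_edge:
  fixes G :: "'v::finite graph"
  assumes "acyclic G" "covered G y z"
  shows "acyclic (reverse_edge G y z)"
proof -
  obtain r where "topo r G" using acyclic_ex_topo assms(1) .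
  then show ?thesis
    using covered_orders[OF _ assms(2)] acyclic_topo by metis
qed

lemma edge_op_acyclic:
  fixes G :: "'v::finite graph"
  shows "edge_op G G' \<Longrightarrow> acyclic G'"
  by (induction rule: edge_op.induct) (auto intro: acyclic_reverse_edge)

text \<open>The weak union rule. The factor \<open>marg p C x\<close> is cancelled; where it is
  zero, both sides vanish.\<close>

lemma screens_enlarge:
  fixes B :: "'v::finite set"
  assumes s: "screens p C B w" and sub: "C \<subseteq> C'" "C' \<subseteq> B" "w \<notin> B"
  shows "screens p C' B w"
  unfolding screens_def
proof
  fix x
  have s': "screens p C C' w" by (rule screens_subset[OF s]) (use sub in auto)
  show "marg p (insert w B) x * marg p C' x = marg p (insert w C') x * marg p B x"
  proof (cases "marg p C x = 0")
    case True
    show ?thesis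
      using marg_eq_0_mono[OF True, of B] marg_eq_0_mono[OF True, of C'] sub by simp
  next
    case False
    have "(marg p (insert w B) x * marg p C' x) * marg p C x
        = (marg p (insert w C') x * marg p B x) * marg p C x"
      using s[unfolded screens_def, rule_format, of x] s'[unfolded screens_def, rule_format, of x]
      by algebra
    with False show ?thesis by simp
  qed
qed

text \<open>The contraction rule, obtained by cancelling \<open>marg p C' x\<close> in the same
  way.\<close>

lemma screens_contract:
  assumes s: "screens p C' B w" and s': "screens p C C' w" and sub: "C \<subseteq> C'" "C' \<subseteq> B"
  shows "screens p C B w"
  unfolding screens_def
proof
  fix x
  show "marg p (insert w B) x * marg p C x = marg p (insert w C) x * marg p B x"
  proof (cases "marg p C' x = 0")
    case True
    show ?thesis
      using marg_eq_0_mono[OF True, of B] marg_eq_0_mono[OF True, of "insert w B"] sub by auto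
  next
    case False
    have "(marg p (insert w B) x * marg p C x) * marg p C' x
        = (marg p (insert w C) x * marg p B x) * marg p C' x"
      using s[unfolded screens_def, rule_format, of x] s'[unfolded screens_def, rule_format, of x]
      by algebra
    with False show ?thesis by simp
  qed
qed

section \<open>Effect of the edge operations on included distributions\<close>

lemma dag_includes_add:
  fixes G :: "'v::finite graph"
  assumes "acyclic (insert (j, i) G)" "dag_includes G p"
  shows "dag_includes (insert (j, i) G) p"
proof -
  obtain r where r: "topo r (insert (j, i) G)" using acyclic_ex_topo assms(1) .
  then have rG: "topo r G" by (auto simp: topo_def)
  show ?thesis
  proof (rule screens_dag_includes[OF r])
    fix w
    show "screens p (parents (insert (j, i) G) w) (preds r w) w"
      by (rule screens_enlarge[OF dag_includes_screens[OF rG assms(2)]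
          _ parents_subset_preds[OF r] not_in_preds]) (auto simp: parents_insert)
  qed
qed

text \<open>One order serves both graphs, and only the parents of \<open>i\<close> differ; there
  contraction combines the Markov property with \<open>ci\<close>.\<close>

lemma dag_includes_delete:
  fixes G :: "'v::finite graph"
  assumes "acyclic (insert (j, i) G)" "(j, i) \<notin> G" "dag_includes (insert (j, i) G) p"
    and ci: "cond_indep p {j} {i} (parents G i)"
  shows "dag_includes G p"
proof -
  obtain r where r: "topo r (insert (j, i) G)" using acyclic_ex_topo assms(1) .
  then have rG: "topo r G" by (auto simp: topo_def)
  have "j \<notin> parents G i" using assms(2) by (simp add: parents_def)
  then have ci': "screens p (parents G i) (insert j (parents G i)) i"
    using ci cond_indep_single_screens by metis
  show ?thesis
  proof (rule screens_dag_includes[OF rG])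
    fix w
    show "screens p (parents G w) (preds r w) w"
    proof (cases "w = i")
      case True
      then show ?thesis
        using dag_includes_screens[OF r assms(3), of i] parents_subset_preds[OF r, of i] ci'
        by (auto simp: parents_insert intro: screens_contract)
    next
      case False
      then show ?thesis
        using dag_includes_screens[OF r assms(3), of w] by (simp add: parents_insert)
    qed
  qed
qed

text \<open>In an order of the larger graph \<open>j\<close> precedes \<open>i\<close>, so in
  \<open>G\<close> it is a predecessor of \<open>i\<close> outside its parents, and the Markov
  property of \<open>G\<close> applies.\<close>

lemma dag_includes_missing_edge:
  fixes G :: "'v::finite graph"
  assumes "acyclic (insert (j, i) G)" "(j, i) \<notin> G" "dag_includes G p"
  shows "cond_indep p {j} {i} (parents G i)"
proof -
  obtain r where r: "topo r (insert (j, i) G)" using acyclic_ex_topo assms(1) .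
  then have rG: "topo r G" by (auto simp: topo_def)
  have "j \<notin> parents G i" using assms(2) by (simp add: parents_def)
  moreover have "screens p (parents G i) (insert j (parents G i)) i"
    by (rule screens_subset[OF dag_includes_screens[OF rG assms(3)] _ _ not_in_preds])
      (use parents_subset_preds[OF r, of i] in \<open>auto simp: parents_insert\<close>)
  ultimately show ?thesis using cond_indep_single_screens by metis
qed

text \<open>In suitable orders \<open>y\<close> and \<open>z\<close> are consecutive, and since the
  edge is covered, the pair depends on its predecessors \<open>B\<close> only through
  \<open>?C\<close>. The conditional law of the pair can be factored in either order.\<close>

lemma dag_includes_reverse_edge:
  fixes G :: "'v::finite graph"
  assumes acyc: "acyclic G" and cov: "covered G y z" and inc: "dag_includes G p"
  shows "dag_includes (reverse_edge G y z) p"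
proof -
  obtain r where "topo r G" using acyclic_ex_topo acyc .
  then obtain r1 r2 B where r1: "topo r1 G" and r2: "topo r2 (reverse_edge G y z)"
    and preds: "preds r1 y = B" "preds r1 z = insert y B" "preds r2 z = B" "preds r2 y = insert z B"
    and other: "\<And>v. v \<noteq> y \<Longrightarrow> v \<noteq> z \<Longrightarrow> preds r1 v = preds r2 v"
    and yz: "y \<notin> B" "z \<notin> B" "y \<noteq> z"
    using covered_orders[OF _ cov] by metis
  note pa = parents_reverse_edge[OF acyc cov]
  let ?C = "parents G y"
  have CB: "?C \<subseteq> B" using parents_subset_preds[OF r1, of y] preds by simp
  have z: "parents G z = insert y ?C" using cov by (simp add: covered_def)
  have sy: "screens p ?C B y"
    using dag_includes_screens[OF r1 inc, of y] preds by simp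
  have sz: "screens p (insert y ?C) (insert y B) z"
    using dag_includes_screens[OF r1 inc, of z] preds z by simp
  have joint: "marg p (insert y (insert z B)) x * marg p ?C x
      = marg p (insert y (insert z ?C)) x * marg p B x" for x
  proof (cases "marg p (insert y ?C) x = 0")
    case True
    have "marg p (insert y (insert z B)) x = 0" "marg p (insert y (insert z ?C)) x = 0"
      by (rule marg_eq_0_mono[OF True]; use CB in auto)+
    then show ?thesis by simp
  next
    case False
    have "(marg p (insert y (insert z B)) x * marg p ?C x) * marg p (insert y ?C) x
      = (marg p (insert y (insert z ?C)) x * marg p B x) * marg p (insert y ?C) x"
      using sy[unfolded screens_def, rule_format, of x] sz[unfolded screens_def, rule_format, of x]
      unfolding insert_commute[of z y] by algebra
    with False show ?thesis by simp
  qed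
  have sz': "screens p ?C B z"
    unfolding screens_def
  proof
    fix x
    show "marg p (insert z B) x * marg p ?C x = marg p (insert z ?C) x * marg p B x"
      by (rule marg_sum_out[OF _ _ _ _ joint]) (use yz CB in \<open>auto intro!: marg_upd\<close>)
  qed
  have sy': "screens p (insert z ?C) (insert z B) y"
    unfolding screens_def
  proof
    fix x
    show "marg p (insert y (insert z B)) x * marg p (insert z ?C) x
        = marg p (insert y (insert z ?C)) x * marg p (insert z B) x"
    proof (cases "marg p ?C x = 0")
      case True
      have "marg p (insert z ?C) x = 0" "marg p (insert y (insert z ?C)) x = 0"
        by (rule marg_eq_0_mono[OF True]; auto)+
      then show ?thesis by simp
    next
      case False
      have "(marg p (insert y (insert z B)) x * marg p (insert z ?C) x) * marg p ?C x
          = (marg p (insert y (insert z ?C)) x * marg p (insert z B) x) * marg p ?C x"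
        using joint[of x] sz'[unfolded screens_def, rule_format, of x] by algebra
      with False show ?thesis by simp
    qed
  qed
  show ?thesis
  proof (rule screens_dag_includes[OF r2])
    fix w
    show "screens p (parents (reverse_edge G y z) w) (preds r2 w) w"
      using sy' sz' dag_includes_screens[OF r1 inc, of w] other[of w] yz preds
      by (auto simp: pa)
  qed
qed

lemma edge_op_includes:
  fixes G :: "'v::finite graph"
  shows "edge_op G G' \<Longrightarrow> dag_includes G p \<Longrightarrow> dag_includes G' p"
  by (induction rule: edge_op.induct) (auto intro: dag_includes_add dag_includes_reverse_edge)

lemma edge_ops_includes:
  fixes G :: "'v::finite graph"
  shows "edge_op\<^sup>*\<^sup>* G G' \<Longrightarrow> dag_includes G p \<Longrightarrow> dag_includes G' p"
  by (induction rule: rtranclp_induct) (auto intro: edge_op_includes)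

lemma edge_ops_dag_le:
  fixes G :: "'v::finite graph"
  shows "edge_op\<^sup>*\<^sup>* G G' \<Longrightarrow> dag_le G G'"
  unfolding dag_le_def using edge_ops_includes by blast

lemma edge_ops_acyclic:
  fixes G :: "'v::finite graph"
  shows "edge_op\<^sup>*\<^sup>* G G' \<Longrightarrow> acyclic G \<Longrightarrow> acyclic G'"
  by (induction rule: rtranclp_induct) (auto intro: edge_op_acyclic)

text \<open>All intermediate graphs are acyclic, being contained in \<open>G'\<close>, so the
  missing edges can be added in any order.\<close>

lemma edge_ops_superset:
  fixes G :: "'v::finite graph"
  assumes "G \<subseteq> G'" "acyclic G'"
  shows "edge_op\<^sup>*\<^sup>* G G'"
proof -
  have "edge_op\<^sup>*\<^sup>* G (G \<union> D)" if "D \<subseteq> G'" for D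
    using finite[of D] that
  proof (induction D rule: finite_induct)
    case (insert e D)
    obtain j i where e: "e = (j, i)" by (cases e)
    have "acyclic (insert (j, i) (G \<union> D))"
      using assms insert.prems e by (intro acyclic_subset[OF assms(2)]) auto
    then have "edge_op\<^sup>*\<^sup>* (G \<union> D) (insert (j, i) (G \<union> D))"
      by (cases "(j, i) \<in> G \<union> D") (auto simp: insert_absorb intro: edge_op.add)
    with insert show ?case by (auto simp: e)
  qed simp
  from this[of G'] assms(1) show ?thesis by (simp add: Un_absorb1)
qed

section \<open>Equivalence and edge counts along chains of operations\<close>

lemma edge_op_reverse_edge_dag_equiv:
  fixes G :: "'v::finite graph"
  assumes "acyclic G" "covered G y z"
  shows "dag_equiv G (reverse_edge G y z)"
proof -
  have "edge_op G (reverse_edge G y z)"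
    using assms by (rule edge_op.reverse)
  moreover have "edge_op (reverse_edge G y z) G"
    using edge_op.reverse[OF acyclic_reverse_edge[OF assms] covered_reverse_edge[OF assms]]
    by (simp add: reverse_reverse_edge[OF assms])
  ultimately show ?thesis
    unfolding dag_equiv_def using edge_ops_dag_le by blast
qed

lemma card_reverse_edge:
  fixes G :: "'v::finite graph"
  assumes "acyclic G" "covered G y z"
  shows "card (reverse_edge G y z) = card G"
proof -
  have "(y, z) \<in> G" "(z, y) \<notin> G"
    using assms acyclic_no_2cycle[OF assms(1), of y z] by (auto simp: covered_def)
  then have "Suc (card (G - {(y, z)})) = card G"
    by (intro card_Suc_Diff1) auto
  with \<open>(z, y) \<notin> G\<close> show ?thesis
    by (simp add: reverse_edge_def)
qed

lemma dag_equiv_refl: "dag_equiv G G"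
  by (simp add: dag_equiv_def dag_le_def)

lemma dag_equiv_sym: "dag_equiv G H \<Longrightarrow> dag_equiv H G"
  by (simp add: dag_equiv_def)

lemma dag_le_trans: "dag_le G H \<Longrightarrow> dag_le H K \<Longrightarrow> dag_le G K"
  unfolding dag_le_def by blast

lemma dag_equiv_trans: "dag_equiv G H \<Longrightarrow> dag_equiv H K \<Longrightarrow> dag_equiv G K"
  unfolding dag_equiv_def using dag_le_trans by blast

text \<open>After the last addition only reversals follow, and these keep both the class and the
  edge count. The graph \<open>F\<close> just before it lies one edge below \<open>H\<close> and
  still above \<open>G\<close>.\<close>

lemma edge_ops_last_add:
  fixes G :: "'v::finite graph"
  assumes "edge_op\<^sup>*\<^sup>* G H"
  shows "card G = card H \<and> dag_equiv G H \<or>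
    card G < card H \<and> (\<exists>F j i. edge_op\<^sup>*\<^sup>* G F \<and> (j, i) \<notin> F \<and> acyclic (insert (j, i) F) \<and>
      dag_equiv (insert (j, i) F) H \<and> card H = Suc (card F))"
  using assms
proof (induction rule: rtranclp_induct)
  case base
  show ?case by (simp add: dag_equiv_refl)
next
  case (step H H')
  from step.hyps(2) show ?case
  proof cases
    case (add j i)
    then have card: "card H' = Suc (card H)" by simp
    have "card G \<le> card H" using step.IH by linarith
    then have "card G < card H'" using card by simp
    with step.hyps(1) add dag_equiv_refl[of H'] card show ?thesis by metis
  next
    case (reverse y z)
    then have "dag_equiv H H'" "card H' = card H"
      using edge_op_reverse_edge_dag_equiv card_reverse_edge by blast+
    with step.IH show ?thesis
      using dag_equiv_trans[of _ H H'] by metis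
  qed
qed

section \<open>Separation in moral graphs\<close>

definition anc :: "'v graph \<Rightarrow> 'v set \<Rightarrow> 'v set" where
  "anc G A = {v. \<exists>a\<in>A. (v, a) \<in> G\<^sup>*}"

definition family :: "'v graph \<Rightarrow> 'v \<Rightarrow> 'v set" where
  "family G s = insert s (parents G s)"

text \<open>The moral graph of the ancestors of \<open>A\<close> with \<open>C\<close> removed:
  making each family a clique joins the parents of a common child.\<close>

definition moral_rel :: "'v graph \<Rightarrow> 'v set \<Rightarrow> 'v set \<Rightarrow> 'v rel" where
  "moral_rel G A C = {(a, b). a \<notin> C \<and> b \<notin> C \<and> (\<exists>s\<in>anc G A. a \<in> family G s \<and> b \<in> family G s)}"

definition separated :: "'v graph \<Rightarrow> 'v set \<Rightarrow> 'v set \<Rightarrow> 'v \<Rightarrow> bool" where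
  "separated G A C w \<longleftrightarrow> (\<forall>t\<in>A. (w, t) \<in> (moral_rel G A C)\<^sup>* \<longrightarrow> t = w)"

lemma subset_anc: "A \<subseteq> anc G A"
  by (auto simp: anc_def)

lemma anc_edge: "(u, v) \<in> G \<Longrightarrow> v \<in> anc G A \<Longrightarrow> u \<in> anc G A"
  by (auto simp: anc_def intro: converse_rtrancl_into_rtrancl)

lemma anc_subset:
  assumes "A \<subseteq> X" "\<And>u v. (u, v) \<in> G \<Longrightarrow> v \<in> X \<Longrightarrow> u \<in> X"
  shows "anc G A \<subseteq> X"
proof
  fix v assume "v \<in> anc G A"
  then obtain a where "a \<in> A" "(v, a) \<in> G\<^sup>*" by (auto simp: anc_def)
  from this(2) show "v \<in> X"
    by (induction rule: converse_rtrancl_induct) (use assms \<open>a \<in> A\<close> in auto)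
qed

lemma separated_mono:
  assumes "separated G A C w" "moral_rel G' A C \<subseteq> (moral_rel G A C)\<^sup>*"
  shows "separated G' A C w"
  using assms rtrancl_subset_rtrancl[OF assms(2)] unfolding separated_def by blast

subsection \<open>Completeness of separation\<close>

text \<open>
  State \<open>2\<close> means failure: it may occur anywhere, is inherited by all descendants, and is
  forced where members of \<open>K\<close> in one family disagree. Hence, if nothing in \<open>A\<close> fails, nothing
  in \<open>anc G A\<close> fails, and all members of \<open>K\<close> have the same bit when \<open>K\<close> is a component of
  the moral graph.
\<close>

definition allowed :: "'v graph \<Rightarrow> 'v set \<Rightarrow> 'v \<Rightarrow> ('v \<Rightarrow> nat) \<Rightarrow> nat set" where
  "allowed G K i c = {2} \<union> {b. b < 2 \<and> (\<forall>u\<in>parents G i. c u \<noteq> 2) \<and>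
     (\<forall>u\<in>parents G i \<inter> K. \<forall>v\<in>parents G i \<inter> K. c u = c v) \<and>
     (i \<in> K \<longrightarrow> (\<forall>u\<in>parents G i \<inter> K. c u = b))}"

lemma allowed_subset: "allowed G K i c \<subseteq> {0, 1, 2}"
  by (auto simp: allowed_def)

lemma allowed_restrict: "allowed G K i (restrict c (parents G i)) = allowed G K i c"
  by (auto simp: allowed_def)

text \<open>Each variable is uniform on its allowed states, which always include state 2; a product
  is nonzero exactly if all its factors are.\<close>

lemma ex_failure_pmf:
  fixes G :: "'v::finite graph"
  assumes "acyclic G"
  obtains q :: "('v \<Rightarrow> nat) pmf" where "dag_includes G q"
    "\<And>x. x \<in> set_pmf q \<longleftrightarrow> (\<forall>i. x i \<in> allowed G K i x)"
proof -
  obtain r where r: "topo r G" using acyclic_ex_topo assms .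
  define k where "k i c = pmf_of_set (allowed G K i c)" for i c
  obtain q where q: "\<And>x. pmf q x = (\<Prod>i\<in>UNIV. pmf (k i (restrict x (parents G i))) (x i))"
    using ex_joint_pmf[OF r, of k] by blast
  have fin: "finite (allowed G K i c)" "allowed G K i c \<noteq> {}" for i c
    by (rule finite_subset[OF allowed_subset]) (simp_all add: allowed_def)
  have "x \<in> set_pmf q \<longleftrightarrow> (\<forall>i. x i \<in> allowed G K i x)" for x
    using fin by (simp add: set_pmf_iff q k_def allowed_restrict indicator_eq_0_iff)
  moreover have "dag_includes G q"
    unfolding dag_includes_def by (intro exI allI, rule q)
  ultimately show thesis using that by blast
qed

text \<open>Absent failures, all vertices connected to \<open>w\<close> carry the same bit as
  \<open>w\<close>. As \<open>H\<close> includes this distribution too, the bit of \<open>w\<close>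
  could be exchanged without touching its predecessors, so none of them can be connected to
  \<open>w\<close>.\<close>

lemma dag_le_separated:
  fixes G H :: "'v::finite graph"
  assumes le: "dag_le G H" and acyc: "acyclic G" and r: "topo r H"
  shows "separated G (insert w (preds r w)) (parents H w) w"
  unfolding separated_def
proof (intro ballI impI)
  let ?B = "preds r w" and ?C = "parents H w"
  let ?A = "insert w ?B"
  define M where "M = moral_rel G ?A ?C"
  fix t assume t: "t \<in> ?A" "(w, t) \<in> (moral_rel G ?A ?C)\<^sup>*"
  define K where "K = {v. (w, v) \<in> M\<^sup>*}"
  have CB: "?C \<subseteq> ?B" using r by (rule parents_subset_preds)
  have wC: "w \<notin> ?C" using CB not_in_preds[of w r] by blast
  have KC: "K \<inter> ?C = {}"
  proof -
    have "v \<notin> ?C" if "(w, v) \<in> M\<^sup>*" for v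
      using that by cases (use wC in \<open>auto simp: M_def moral_rel_def\<close>)
    then show ?thesis by (auto simp: K_def)
  qed
  obtain q where inc: "dag_includes G q"
    and supp: "\<And>x. x \<in> set_pmf q \<longleftrightarrow> (\<forall>i. x i \<in> allowed G K i x)"
    using ex_failure_pmf[OF acyc, of K] by blast
  have "finite_states (\<lambda>_ :: 'v. {0, 1, 2 :: nat})" by (simp add: finite_states_def)
  moreover have "distribution_on (\<lambda>_. {0, 1, 2}) q"
    unfolding distribution_on_def configs_def
  proof (intro subsetI CollectI allI)
    fix z i assume "z \<in> set_pmf q"
    then show "z i \<in> {0, 1, 2}"
      using allowed_subset[of G K i z] supp[of z] by blast
  qed
  ultimately have "dag_includes H q"
    using le inc unfolding dag_le_def by blast
  then have scr: "screens q ?C ?B w"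
    using r by (rule dag_includes_screens[rotated])
  \<comment> \<open>Two configurations of the support, with bit 0 or 1 on \<open>K\<close> and
    failure outside the ancestors; they agree on \<open>?C\<close> because \<open>K\<close> avoids
    it.\<close>
  define x where "x b v = (if v \<notin> anc G ?A then 2 else if v \<in> K then b else 0)"
    for b :: nat and v
  have x_supp: "x b \<in> set_pmf q" if b: "b < 2" for b
    unfolding supp
  proof
    fix i
    show "x b i \<in> allowed G K i (x b)"
    proof (cases "i \<in> anc G ?A")
      case True
      then have "u \<in> anc G ?A" if "u \<in> parents G i" for u
        using that by (auto simp: parents_def intro: anc_edge)
      with True b show ?thesis by (auto simp: x_def allowed_def)
    qed (simp add: x_def allowed_def)
  qed
  have same: "x 0 v = x 1 v" if "v \<in> ?C" for v
    using KC that by (auto simp: x_def)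
  \<comment> \<open>The value of \<open>w\<close> is taken from \<open>x 0\<close> and the rest from
    \<open>x 1\<close>; screening gives this mixture positive probability on
    \<open>?A\<close>.\<close>
  define y where "y = (x 1)(w := x 0 w)"
  have "marg q (insert w ?C) y \<noteq> 0"
    unfolding marg_pos_iff by (rule bexI[OF _ x_supp[of 0]]) (use same in \<open>auto simp: agree_on_def y_def\<close>)
  moreover have "marg q ?B y \<noteq> 0"
    unfolding marg_pos_iff
    by (rule bexI[OF _ x_supp[of 1]]) (use not_in_preds[of w r] in \<open>auto simp: agree_on_def y_def\<close>)
  ultimately have "marg q ?A y \<noteq> 0"
    using scr[unfolded screens_def, rule_format, of y] by (metis mult_eq_0_iff)
  then obtain z where z: "z \<in> set_pmf q" and zy: "\<And>v. v \<in> ?A \<Longrightarrow> z v = y v"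
    unfolding marg_pos_iff agree_on_def by blast
  have y2: "y v \<noteq> 2" if "v \<in> ?A" for v
  proof -
    have "v \<in> anc G ?A" using that subset_anc[of ?A G] by blast
    then show ?thesis by (auto simp: y_def x_def)
  qed
  \<comment> \<open>A failure at an ancestor would be handed down to a member of \<open>?A\<close>,
    where \<open>y\<close> shows none.\<close>
  have ok: "z v \<noteq> 2" if v: "v \<in> anc G ?A" for v
  proof -
    obtain a where a: "a \<in> ?A" "(v, a) \<in> G\<^sup>*" using v unfolding anc_def by blast
    from a(2) show ?thesis
    proof (induction rule: converse_rtrancl_induct)
      case base
      then show ?case using a(1) zy y2 by simp
    next
      case (step u u')
      have "z u' \<in> allowed G K u' z" using z supp by blast
      with step show ?case by (auto simp: allowed_def parents_def)
    qed
  qed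
  \<comment> \<open>Without failure, members of \<open>K\<close> in one family must agree, and
    agreement spreads along the component.\<close>
  have const: "z v = z w" if "(w, v) \<in> M\<^sup>*" for v
    using that
  proof (induction rule: rtrancl_induct)
    case (step u v)
    obtain s where s: "s \<in> anc G ?A" "u \<in> family G s" "v \<in> family G s"
      using step.hyps(2) unfolding M_def moral_rel_def by blast
    have "u \<in> K" "v \<in> K"
      using step.hyps by (auto simp: K_def)
    moreover have "z s \<in> allowed G K s z" using z supp by blast
    ultimately have "z u = z v"
      using s ok[OF s(1)] by (auto simp: allowed_def family_def)
    with step.IH show ?case by simp
  qed simp
  have K: "w \<in> K" "t \<in> K" using t(2) by (auto simp: K_def M_def)
  have anc: "w \<in> anc G ?A" "t \<in> anc G ?A" using t(1) subset_anc[of ?A G] by blast+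
  have "z t = z w" using t(2) by (intro const) (simp add: M_def)
  then have "y t = y w" using zy t(1) by simp
  then show "t = w" using K anc by (auto simp: y_def x_def split: if_splits)
qed

subsection \<open>Turning an edge around\<close>

definition cover_edge :: "'v graph \<Rightarrow> 'v \<Rightarrow> 'v \<Rightarrow> 'v graph" where
  "cover_edge G y z = G \<union> parents G y \<times> {z} \<union> (parents G z - {y}) \<times> {y}"

definition turn_edge :: "'v graph \<Rightarrow> 'v \<Rightarrow> 'v \<Rightarrow> 'v graph" where
  "turn_edge G y z = reverse_edge (cover_edge G y z) y z"

text \<open>By \<open>direct\<close>, the edge is the only path from \<open>y\<close> to
  \<open>z\<close>. The other ancestors of \<open>y\<close> and \<open>z\<close> can therefore all
  be placed before \<open>y\<close>, and the covering edges close no cycle.\<close>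

lemma edge_ops_turn_edge:
  fixes G :: "'v::finite graph"
  assumes acyc: "acyclic G" and yz: "(y, z) \<in> G"
    and direct: "\<And>w. (y, w) \<in> G \<Longrightarrow> (w, z) \<in> G\<^sup>+ \<Longrightarrow> False"
  shows "edge_op\<^sup>*\<^sup>* G (turn_edge G y z)"
proof -
  let ?F = "cover_edge G y z"
  obtain r where r: "topo r G" using acyclic_ex_topo acyc .
  obtain N where N: "{u. r u < N} = UNIV" by (rule rank_bounded)
  then have rN: "r u < N" for u by blast
  have no_cycle: "(v, v) \<notin> G\<^sup>+" for v using acyc by (simp add: acyclic_def)
  define B where "B = {v. v \<noteq> y \<and> ((v, y) \<in> G\<^sup>+ \<or> (v, z) \<in> G\<^sup>+)}"
  have y_ne_z: "y \<noteq> z" using yz no_cycle[of y] by blast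
  have yB: "y \<notin> B" by (simp add: B_def)
  have zB: "z \<notin> B" using no_cycle[of y] no_cycle[of z] yz unfolding B_def
    by (auto dest: trancl_into_trancl2)
  have pB: "a \<in> B" if "(a, b) \<in> G" "b \<in> B" for a b
  proof -
    have b: "(b, y) \<in> G\<^sup>+ \<or> (b, z) \<in> G\<^sup>+" using that(2) by (simp add: B_def)
    then have "a \<noteq> y"
      using that(1) direct[of b] no_cycle[of y] by (auto dest: trancl_into_trancl2)
    with b that(1) show ?thesis
      by (auto simp: B_def dest: trancl_into_trancl2)
  qed
  have pyz: "a \<in> B" if "(a, y) \<in> G \<or> (a, z) \<in> G" "a \<noteq> y" for a
    using that by (auto simp: B_def)
  have yy: "(y, y) \<notin> G" using no_cycle[of y] by blast
  \<comment> \<open>Four blocks: the ancestors in \<open>B\<close>, then \<open>y\<close>, then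
    \<open>z\<close>, then all remaining vertices.\<close>
  define c where
    "c v = (if v \<in> B then r v else if v = y then N else if v = z then N + 1 else N + 2 + r v)" for v
  have "c a < c b" if ab: "(a, b) \<in> ?F" for a b
  proof -
    consider (B) "b \<in> B" "(a, b) \<in> G" | (y) "b = y" "a \<in> B" | (z) "b = z" "a \<in> insert y B"
      | (other) "b \<notin> B" "b \<noteq> y" "b \<noteq> z" "(a, b) \<in> G"
      using ab yB zB yy pyz[of a] unfolding cover_edge_def parents_def by blast
    then show ?thesis
    proof cases
      case B
      then show ?thesis using pB[of a b] topoD[OF r B(2)] by (simp add: c_def)
    next
      case y
      then show ?thesis using yB rN by (simp add: c_def)
    next
      case z
      then show ?thesis using yB zB y_ne_z rN[of a] by (auto simp: c_def)
    next
      case other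
      then show ?thesis using topoD[OF r other(4)] rN[of a] by (auto simp: c_def)
    qed
  qed
  then have acycF: "acyclic ?F"
    using acyclic_rank[of ?F c] acyclic_topo by metis
  have "covered ?F y z"
    using yz yy y_ne_z by (auto simp: covered_def cover_edge_def parents_def)
  then have "edge_op ?F (turn_edge G y z)"
    unfolding turn_edge_def by (rule edge_op.reverse[OF acycF])
  moreover have "edge_op\<^sup>*\<^sup>* G ?F"
    by (rule edge_ops_superset[OF _ acycF]) (auto simp: cover_edge_def)
  ultimately show ?thesis by simp
qed

text \<open>
  Any two members of a changed family are equal or adjacent to \<open>y\<close> in the old moral graph,
  and \<open>y\<close> is not in the conditioning set.
\<close>

lemma separated_turn_edge:
  assumes yz: "(y, z) \<in> G" and yC: "y \<notin> C"
    and anc: "y \<in> anc G A \<Longrightarrow> z \<in> anc G A" and sep: "separated G A C w"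
  shows "separated (turn_edge G y z) A C w"
proof (rule separated_mono[OF sep])
  let ?G = "turn_edge G y z" and ?M = "moral_rel G A C"
  have new: "v = z \<or> v \<in> parents G y \<or> v \<in> parents G z" "u = y \<or> u = z"
    if "(v, u) \<in> ?G" "(v, u) \<notin> G" for v u
    using that by (auto simp: turn_edge_def reverse_edge_def cover_edge_def)
  \<comment> \<open>Being ancestors of \<open>A\<close> together or not at all, \<open>y\<close> and
    \<open>z\<close> let the new edges bring in no new ancestor.\<close>
  have yz_anc: "y \<in> anc G A \<longleftrightarrow> z \<in> anc G A"
    using anc anc_edge[OF yz] by blast
  have anc_sub: "anc ?G A \<subseteq> anc G A"
  proof (rule anc_subset[OF subset_anc])
    fix u v assume uv: "(u, v) \<in> ?G" "v \<in> anc G A"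
    show "u \<in> anc G A"
    proof (cases "(u, v) \<in> G")
      case True
      then show ?thesis using uv(2) by (rule anc_edge)
    next
      case False
      with new[OF uv(1)] uv(2) yz_anc show ?thesis
        using anc_edge[of u y G A] anc_edge[of u z G A] by (auto simp: parents_def)
    qed
  qed
  have fam_other: "family ?G s = family G s" if "s \<noteq> y" "s \<noteq> z" for s
    using that by (auto simp: family_def parents_def turn_edge_def reverse_edge_def cover_edge_def)
  have fam: "family ?G s \<subseteq> family G y \<union> family G z" if "s = y \<or> s = z" for s
    using that yz by (auto simp: family_def parents_def turn_edge_def reverse_edge_def cover_edge_def)
  have y_fam: "y \<in> family G y" "y \<in> family G z"
    using yz by (auto simp: family_def parents_def)
  show "moral_rel ?G A C \<subseteq> ?M\<^sup>*"
  proof safe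
    fix a b assume "(a, b) \<in> moral_rel ?G A C"
    then obtain s where s: "s \<in> anc ?G A" "a \<in> family ?G s" "b \<in> family ?G s"
      and C: "a \<notin> C" "b \<notin> C" by (auto simp: moral_rel_def)
    have sG: "s \<in> anc G A" using s(1) anc_sub by blast
    show "(a, b) \<in> ?M\<^sup>*"
    proof (cases "s = y \<or> s = z")
      case True
      then have A: "y \<in> anc G A" "z \<in> anc G A" using sG yz_anc by auto
      have "a \<in> family G y \<union> family G z" "b \<in> family G y \<union> family G z"
        using fam[OF True] s by auto
      then have "(a, y) \<in> ?M" "(y, b) \<in> ?M"
        using y_fam A C yC by (auto simp: moral_rel_def)
      then show ?thesis by simp
    next
      case False
      then have "(a, b) \<in> ?M"
        using s sG C fam_other[of s] by (auto simp: moral_rel_def)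
      then show ?thesis ..
    qed
  qed
qed

section \<open>Model inclusion is generated by edge operations\<close>

text \<open>
  The invariant of the transformation of \<open>G\<close> into \<open>H\<close>, which processes the vertices by
  decreasing rank.
\<close>

definition settled :: "'v graph \<Rightarrow> ('v \<Rightarrow> nat) \<Rightarrow> nat \<Rightarrow> 'v graph \<Rightarrow> bool" where
  "settled H r k G \<longleftrightarrow> acyclic G \<and>
     (\<forall>v. k \<le> r v \<longrightarrow> parents G v = parents H v) \<and>
     (\<forall>a b. (a, b) \<in> G \<longrightarrow> k \<le> r a \<longrightarrow> k \<le> r b) \<and>
     (\<forall>w. r w < k \<longrightarrow> separated G (insert w (preds r w)) (parents H w) w)"

text \<open>The turned edge leads towards the descendant \<open>d\<close> of least rank. An initial
  segment up to \<open>y\<close> that has \<open>y\<close> as an ancestor contains \<open>d\<close>,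
  hence has \<open>z\<close> as an ancestor too; so its separation survives.\<close>

lemma settled_turn_edge:
  fixes G H :: "'v::finite graph"
  assumes r: "topo r H" and G: "settled H r (Suc (r y)) G" and child: "(y, x) \<in> G" "r x \<le> r y"
  obtains z where "(y, z) \<in> G" "r z \<le> r y" "edge_op\<^sup>*\<^sup>* G (turn_edge G y z)"
    "settled H r (Suc (r y)) (turn_edge G y z)"
proof -
  have acyc: "acyclic G" and par: "\<And>v. r y < r v \<Longrightarrow> parents G v = parents H v"
    and closed: "\<And>a b. (a, b) \<in> G \<Longrightarrow> r y < r a \<Longrightarrow> r y < r b"
    and sep: "\<And>w. r w \<le> r y \<Longrightarrow> separated G (insert w (preds r w)) (parents H w) w"
    using G by (auto simp: settled_def Suc_le_eq less_Suc_eq_le)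
  have less: "r u < r v" if "r u \<le> r v" "u \<noteq> v" for u v
  proof -
    have "inj r" using r by (simp add: topo_def)
    then have "r u \<noteq> r v" using that(2) by (simp add: inj_eq)
    with that(1) show ?thesis by simp
  qed
  have "x \<noteq> y" using child(1) acyclic_no_loop[OF acyc, of y] by auto
  then have "r x < r y" using less[of x y] child(2) by simp
  have yx: "(y, x) \<in> G\<^sup>+" using child(1) by (rule r_into_trancl)
  obtain d where d: "(y, d) \<in> G\<^sup>+" and d_min: "\<And>u. (y, u) \<in> G\<^sup>+ \<Longrightarrow> r d \<le> r u"
    using ex_has_least_nat[of "\<lambda>u. (y, u) \<in> G\<^sup>+", OF yx, of r] by blast
  have rd: "r d < r y"
    using d_min[OF yx] \<open>r x < r y\<close> by linarith
  define Q where "Q = {w. (y, w) \<in> G \<and> (w, d) \<in> G\<^sup>*}"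
  have "wf (G\<^sup>+)"
    using acyc by (intro wf_trancl finite_acyclic_wf) auto
  moreover obtain q where "q \<in> Q"
    using tranclD[OF d] unfolding Q_def by blast
  \<comment> \<open>Minimality excludes a longer path from \<open>y\<close> to \<open>z\<close>: its
    first vertex after \<open>y\<close> would belong to \<open>Q\<close>.\<close>
  ultimately obtain z where z: "z \<in> Q" and z_min: "\<And>w. (w, z) \<in> G\<^sup>+ \<Longrightarrow> w \<notin> Q"
    using wfE_min[of "G\<^sup>+" q Q] by blast
  have yz: "(y, z) \<in> G" and zd: "(z, d) \<in> G\<^sup>*" using z by (auto simp: Q_def)
  \<comment> \<open>Edges do not leave the set of ranks above \<open>r y\<close>, so a child
    \<open>z\<close> there would put \<open>d\<close> there as well.\<close>
  have "r y < r d" if "r y < r z"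
    using zd that by (induction rule: rtrancl_induct) (auto intro: closed)
  then have rz: "r z \<le> r y" using rd by linarith
  have ops: "edge_op\<^sup>*\<^sup>* G (turn_edge G y z)"
  proof (rule edge_ops_turn_edge[OF acyc yz])
    fix w assume "(y, w) \<in> G" "(w, z) \<in> G\<^sup>+"
    moreover from this have "(w, d) \<in> G\<^sup>*"
      using rtrancl_trans[OF trancl_into_rtrancl zd] by blast
    ultimately show False
      using z_min[of w] by (simp add: Q_def)
  qed
  let ?G = "turn_edge G y z"
  have new: "(a, b) \<in> G \<or> (b = y \<or> b = z) \<and> (a = z \<or> (a, y) \<in> G \<or> (a, z) \<in> G)"
    if "(a, b) \<in> ?G" for a b
    using that by (auto simp: turn_edge_def reverse_edge_def cover_edge_def parents_def)
  have "settled H r (Suc (r y)) ?G"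
    unfolding settled_def Suc_le_eq less_Suc_eq_le
  proof (intro conjI allI impI)
    show "acyclic ?G" using edge_ops_acyclic[OF ops acyc] .
    show "parents ?G v = parents H v" if v: "r y < r v" for v
    proof -
      have "v \<noteq> y" "v \<noteq> z" using v rz by auto
      then have "parents ?G v = parents G v"
        by (auto simp: turn_edge_def reverse_edge_def cover_edge_def parents_def)
      then show ?thesis using par[OF v] by simp
    qed
    show "r y < r b" if "(a, b) \<in> ?G" "r y < r a" for a b
      using new[OF that(1)] that(2) rz closed[of a] by fastforce
    show "separated ?G (insert w (preds r w)) (parents H w) w" if w: "r w \<le> r y" for w
    proof (rule separated_turn_edge[OF yz _ _ sep[OF w]])
      show "y \<notin> parents H w"
        using topoD[OF r, of y w] w by (auto simp: parents_def)
      let ?A = "insert w (preds r w)"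
      assume "y \<in> anc G ?A"
      then obtain a where a: "a \<in> ?A" "(y, a) \<in> G\<^sup>*" unfolding anc_def by blast
      have "r a \<le> r w" using a(1) by (auto simp: preds_def)
      moreover have "r d \<le> r a"
        using rtranclD[OF a(2)] d_min[of a] rd by auto
      ultimately have "r d < r w \<or> d = w" using less[of d w] by linarith
      then have "d \<in> ?A" by (auto simp: preds_def)
      with zd show "z \<in> anc G ?A" unfolding anc_def by blast
    qed
  qed
  with yz rz ops that show thesis by blast
qed

text \<open>Turning the edge to \<open>z\<close> gives \<open>y\<close> no new child, so the number
  of its children of rank up to \<open>r y\<close> drops.\<close>

lemma settled_make_sink:
  fixes G H :: "'v::finite graph"
  assumes r: "topo r H" and "settled H r (Suc (r y)) G"
  shows "\<exists>G'. edge_op\<^sup>*\<^sup>* G G' \<and> settled H r (Suc (r y)) G' \<and> (\<forall>x. (y, x) \<in> G' \<longrightarrow> r y < r x)"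
  using assms(2)
proof (induction "card {x. (y, x) \<in> G \<and> r x \<le> r y}" arbitrary: G rule: less_induct)
  case less
  show ?case
  proof (cases "\<exists>x. (y, x) \<in> G \<and> r x \<le> r y")
    case True
    then obtain z where z: "(y, z) \<in> G" "r z \<le> r y" and ops: "edge_op\<^sup>*\<^sup>* G (turn_edge G y z)"
      and s: "settled H r (Suc (r y)) (turn_edge G y z)"
      using settled_turn_edge[OF r less.prems] by metis
    have acyc: "acyclic G" using less.prems by (simp add: settled_def)
    have "(y, y) \<notin> G" "y \<noteq> z"
      using acyclic_no_loop[OF acyc, of y] z(1) by auto
    then have "{x. (y, x) \<in> turn_edge G y z \<and> r x \<le> r y} \<subseteq> {x. (y, x) \<in> G \<and> r x \<le> r y} - {z}"
      by (auto simp: turn_edge_def reverse_edge_def cover_edge_def parents_def)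
    then have "card {x. (y, x) \<in> turn_edge G y z \<and> r x \<le> r y} < card {x. (y, x) \<in> G \<and> r x \<le> r y}"
      using z by (intro psubset_card_mono) auto
    from less.hyps[OF this s] show ?thesis
      using ops by (meson rtranclp_trans)
  next
    case False
    then show ?thesis
      using less.prems by (intro exI[of _ G]) (auto simp: not_le)
  qed
qed

text \<open>A parent of \<open>y\<close> in \<open>G\<close> that is not one in \<open>H\<close>
  would be connected to \<open>y\<close> in the moral graph, so edges into \<open>y\<close> are at
  most missing. Adding them disturbs no earlier separation, since \<open>y\<close> is an ancestor of
  no earlier segment.\<close>

lemma settled_add_parents:
  fixes G H :: "'v::finite graph"
  assumes r: "topo r H" and G: "settled H r (Suc (r y)) G"
    and sink: "\<And>x. (y, x) \<in> G \<Longrightarrow> r y < r x"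
  shows "\<exists>G'. edge_op\<^sup>*\<^sup>* G G' \<and> settled H r (r y) G'"
proof -
  have acyc: "acyclic G" and par: "\<And>v. r y < r v \<Longrightarrow> parents G v = parents H v"
    and closed: "\<And>a b. (a, b) \<in> G \<Longrightarrow> r y < r a \<Longrightarrow> r y < r b"
    and sep: "\<And>w. r w \<le> r y \<Longrightarrow> separated G (insert w (preds r w)) (parents H w) w"
    using G by (auto simp: settled_def Suc_le_eq less_Suc_eq_le)
  have less: "r u < r v" if "r u \<le> r v" "u \<noteq> v" for u v
  proof -
    have "inj r" using r by (simp add: topo_def)
    then have "r u \<noteq> r v" using that(2) by (simp add: inj_eq)
    with that(1) show ?thesis by simp
  qed
  have closed': "r y \<le> r b" if "(a, b) \<in> G" "r y \<le> r a" for a b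
    using closed[OF that(1)] sink[of b] less[of y a] that by (cases "y = a") auto
  have pH: "r x < r y" if "x \<in> parents H y" for x
    using that topoD[OF r] by (auto simp: parents_def)
  have py: "parents G y \<subseteq> parents H y"
  proof
    fix x assume x: "x \<in> parents G y"
    then have xy: "(x, y) \<in> G" by (simp add: parents_def)
    then have "x \<noteq> y" using acyclic_no_loop[OF acyc, of y] by auto
    moreover have "r x \<le> r y" using closed[OF xy] by (meson less_irrefl not_le)
    ultimately have rx: "r x < r y" using less by blast
    show "x \<in> parents H y"
    proof (rule ccontr)
      let ?A = "insert y (preds r y)"
      assume "x \<notin> parents H y"
      moreover have "y \<notin> parents H y" using pH by blast
      moreover have "y \<in> anc G ?A" using subset_anc[of ?A G] by blast
      ultimately have "(y, x) \<in> moral_rel G ?A (parents H y)"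
        using x unfolding moral_rel_def family_def by blast
      moreover have "x \<in> ?A" using rx by (simp add: preds_def)
      ultimately show False
        using sep[of y] \<open>x \<noteq> y\<close> unfolding separated_def by blast
    qed
  qed
  let ?G = "G \<union> parents H y \<times> {y}"
  have acyc': "acyclic ?G"
  proof -
    obtain r0 where r0: "topo r0 G" using acyclic_ex_topo acyc .
    obtain N where N: "{u. r0 u < N} = UNIV" by (rule rank_bounded)
    then have r0N: "r0 u < N" for u by blast
    \<comment> \<open>Vertices of rank below \<open>r y\<close> come first, in their old order, then
      the others. No old edge leads back, and the new edges run from the first block to
      \<open>y\<close>.\<close>
    define c where "c v = (if r v < r y then r0 v else N + r0 v)" for v
    have "c a < c b" if ab: "(a, b) \<in> ?G" for a b
    proof (cases "(a, b) \<in> G")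
      case True
      then show ?thesis
        using topoD[OF r0 True] closed'[OF True] by (auto simp: c_def)
    next
      case False
      then have "a \<in> parents H y" "b = y" using ab by auto
      then show ?thesis using pH[of a] r0N[of a] by (simp add: c_def)
    qed
    then show ?thesis
      using acyclic_rank[of ?G c] acyclic_topo by metis
  qed
  have "settled H r (r y) ?G"
    unfolding settled_def
  proof (intro conjI allI impI)
    show "acyclic ?G" by (rule acyc')
    show "parents ?G v = parents H v" if "r y \<le> r v" for v
    proof (cases "v = y")
      case True
      then show ?thesis using py by (auto simp: parents_def)
    next
      case False
      then have "r y < r v" using that less[of y v] by blast
      then have "parents G v = parents H v" by (rule par)
      with False show ?thesis by (auto simp: parents_def)
    qed
    show "r y \<le> r b" if "(a, b) \<in> ?G" "r y \<le> r a" for a b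
      using that closed'[of a b] by auto
    show "separated ?G (insert w (preds r w)) (parents H w) w" if w: "r w < r y" for w
    proof (rule separated_mono[OF sep])
      show "r w \<le> r y" using w by simp
      let ?A = "insert w (preds r w)"
      have "anc G ?A \<subseteq> {v. r v < r y}"
      proof (rule anc_subset)
        show "?A \<subseteq> {v. r v < r y}" using w by (auto simp: preds_def)
        show "a \<in> {v. r v < r y}" if "(a, b) \<in> G" "b \<in> {v. r v < r y}" for a b
          using closed'[OF that(1)] that(2) by (cases "r y \<le> r a") auto
      qed
      then have y: "y \<notin> anc G ?A" by blast
      have sub: "anc ?G ?A \<subseteq> anc G ?A"
      proof (rule anc_subset[OF subset_anc])
        show "a \<in> anc G ?A" if "(a, b) \<in> ?G" "b \<in> anc G ?A" for a b
          using that y anc_edge[of a b G ?A] by blast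
      qed
      have "family ?G s = family G s" if "s \<noteq> y" for s
        using that by (auto simp: family_def parents_def)
      moreover have "s \<in> anc G ?A" "s \<noteq> y" if "s \<in> anc ?G ?A" for s
        using that sub y by blast+
      ultimately have "moral_rel ?G ?A (parents H w) \<subseteq> moral_rel G ?A (parents H w)"
        unfolding moral_rel_def by fastforce
      then show "moral_rel ?G ?A (parents H w) \<subseteq> (moral_rel G ?A (parents H w))\<^sup>*"
        by blast
    qed
  qed
  moreover have "edge_op\<^sup>*\<^sup>* G ?G"
    by (rule edge_ops_superset[OF _ acyc']) blast
  ultimately show ?thesis by blast
qed

text \<open>A vertex of rank \<open>k\<close> is first made a sink among the unsettled vertices and
  then given its missing parents; at \<open>k = 0\<close> all parent sets agree.\<close>

lemma settled_edge_ops: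
  fixes G H :: "'v::finite graph"
  assumes r: "topo r H"
  shows "settled H r k G \<Longrightarrow> edge_op\<^sup>*\<^sup>* G H"
proof (induction k arbitrary: G)
  case 0
  then have "G = H" by (intro graph_eq_parents) (simp add: settled_def)
  then show ?case by simp
next
  case (Suc k)
  show ?case
  proof (cases "\<exists>y. r y = k")
    case True
    then obtain y where y: "r y = k" by blast
    with Suc.prems have "settled H r (Suc (r y)) G" by simp
    then obtain G' where "edge_op\<^sup>*\<^sup>* G G'" "settled H r (Suc (r y)) G'"
      "\<And>x. (y, x) \<in> G' \<Longrightarrow> r y < r x"
      using settled_make_sink[OF r] by metis
    moreover from this obtain G'' where "edge_op\<^sup>*\<^sup>* G' G''" "settled H r k G''"
      using settled_add_parents[OF r, of y G'] y by metis
    ultimately show ?thesis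
      using Suc.IH[of G''] by (meson rtranclp_trans)
  next
    case False
    then have "Suc k \<le> r v \<longleftrightarrow> k \<le> r v" "r v < Suc k \<longleftrightarrow> r v < k" for v
      by (auto simp: Suc_le_eq less_Suc_eq le_less)
    then have "settled H r k G" using Suc.prems unfolding settled_def by simp
    then show ?thesis by (rule Suc.IH)
  qed
qed

theorem dag_le_edge_ops:
  fixes G H :: "'v::finite graph"
  assumes "acyclic G" "acyclic H" "dag_le G H"
  shows "edge_op\<^sup>*\<^sup>* G H"
proof -
  obtain r where r: "topo r H" using acyclic_ex_topo assms(2) .
  obtain N where N: "{u. r u < N} = UNIV" by (rule rank_bounded)
  then have "\<not> N \<le> r v" for v by (metis UNIV_I mem_Collect_eq not_le)
  \<comment> \<open>No vertex has rank \<open>N\<close> or more, so only acyclicity and the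
    separations have to be shown.\<close>
  then have "settled H r N G"
    using dag_le_separated[OF assms(3,1) r] assms(1) by (simp add: settled_def)
  then show ?thesis by (rule settled_edge_ops[OF r])
qed

section \<open>Consequences for edge counts and inclusion\<close>

lemma edge_op_dag_le:
  fixes G :: "'v::finite graph"
  shows "edge_op G G' \<Longrightarrow> dag_le G G'"
  by (rule edge_ops_dag_le) simp

lemma dag_equiv_card:
  fixes G H :: "'v::finite graph"
  assumes "acyclic G" "acyclic H" "dag_equiv G H"
  shows "card G = card H"
  using edge_ops_last_add[OF dag_le_edge_ops, of G H] edge_ops_last_add[OF dag_le_edge_ops, of H G] assms
  unfolding dag_equiv_def by linarith

lemma dag_le_card_eq:
  fixes G H :: "'v::finite graph"
  assumes "acyclic G" "acyclic H" "dag_le G H"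
  shows "card G \<le> card H" "card G = card H \<Longrightarrow> dag_equiv G H"
  using edge_ops_last_add[OF dag_le_edge_ops[OF assms]] by auto

lemma dag_le_last_add:
  fixes G H :: "'v::finite graph"
  assumes "acyclic G" "acyclic H" "dag_le G H" "card G < card H"
  obtains F j i where "dag_le G F" "acyclic F" "(j, i) \<notin> F" "acyclic (insert (j, i) F)"
    "dag_equiv (insert (j, i) F) H" "card H = Suc (card F)"
proof -
  obtain F j i where F: "edge_op\<^sup>*\<^sup>* G F" "(j, i) \<notin> F" "acyclic (insert (j, i) F)"
    "dag_equiv (insert (j, i) F) H" "card H = Suc (card F)"
    using edge_ops_last_add[OF dag_le_edge_ops[OF assms(1-3)]] assms(4) by auto
  moreover have "dag_le G F" using F(1) by (rule edge_ops_dag_le)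
  moreover have "acyclic F" using edge_ops_acyclic[OF F(1) assms(1)] .
  ultimately show thesis using that by blast
qed

text \<open>\<open>dag_le\<close> quantifies over distributions with natural numbers as states; the
  chain of edge operations carries inclusion over to states of any type.\<close>

lemma dag_le_includes:
  fixes G H :: "'v::finite graph"
  assumes "acyclic G" "acyclic H" "dag_le G H" "dag_includes G p"
  shows "dag_includes H p"
  using edge_ops_includes[OF dag_le_edge_ops[OF assms(1-3)] assms(4)] .

section \<open>Greedy search on equivalence classes\<close>

lemma mem_dag_class: "H \<in> dag_class G \<longleftrightarrow> acyclic G \<and> acyclic H \<and> dag_equiv G H"
  by (simp add: dag_class_def dag_rel_def)

lemma dag_class_in_dag_classes: "acyclic G \<Longrightarrow> dag_class G \<in> dag_classes"
  by (auto simp: dag_classes_def dag_class_def intro: quotientI)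

lemma dag_classesD:
  assumes "E \<in> dag_classes" "G \<in> E"
  shows "acyclic G" "E = dag_class G"
proof -
  obtain K where K: "E = dag_class K" "acyclic K"
    using assms(1) by (auto simp: dag_classes_def dag_class_def elim: quotientE)
  with assms(2) show "acyclic G" by (simp add: mem_dag_class)
  have "dag_equiv K G" using assms(2) K by (simp add: mem_dag_class)
  then have "dag_equiv K H \<longleftrightarrow> dag_equiv G H" for H
    using dag_equiv_trans dag_equiv_sym by metis
  then show "E = dag_class G"
    using K \<open>acyclic G\<close> by (auto simp: set_eq_iff mem_dag_class)
qed

lemma class_members_equiv: "E \<in> dag_classes \<Longrightarrow> G \<in> E \<Longrightarrow> H \<in> E \<Longrightarrow> dag_equiv G H"
  using dag_classesD(2) mem_dag_class by blast

text \<open>Each greedy step strictly decreases the number of states with a higher score.\<close>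

lemma ex_greedy_search:
  fixes E :: "'q::finite"
  shows "\<exists>F. greedy_search move sc E F"
proof (induction "card {F. sc E < sc F}" arbitrary: E rule: less_induct)
  case less
  show ?case
  proof (cases "local_maximum move sc E")
    case True
    then show ?thesis by (auto simp: greedy_search_def)
  next
    case False
    then obtain F0 where F0: "move E F0" "sc E < sc F0"
      by (auto simp: local_maximum_def)
    let ?M = "sc ` {F. move E F}"
    have "Max ?M \<in> ?M" using F0(1) by (intro Max_in) auto
    then obtain F where "move E F" "sc F = Max ?M" by auto
    then have F: "move E F" "\<And>F'. move E F' \<Longrightarrow> sc F' \<le> sc F" by auto
    have "sc E < sc F" using F(2)[OF F0(1)] F0(2) by simp
    then have step: "greedy_step move sc E F"
      using F by (simp add: greedy_step_def)
    have "card {F'. sc F < sc F'} < card {F'. sc E < sc F'}"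
      using \<open>sc E < sc F\<close> by (intro psubset_card_mono) auto
    then obtain K where "greedy_search move sc F K" using less by blast
    with step have "greedy_search move sc E K"
      unfolding greedy_search_def by (meson converse_rtranclp_into_rtranclp)
    then show ?thesis ..
  qed
qed

lemma greedy_search_invariant:
  assumes "greedy_search move sc E F" "P E"
    and "\<And>E F. P E \<Longrightarrow> move E F \<Longrightarrow> sc E < sc F \<Longrightarrow> P F"
  shows "P F"
proof -
  have "(greedy_step move sc)\<^sup>*\<^sup>* E F" using assms(1) by (simp add: greedy_search_def)
  then show ?thesis
    by (induction rule: rtranclp_induct) (use assms(2,3) in \<open>auto simp: greedy_step_def\<close>)
qed

text \<open>The ordered Markov property fails at some \<open>i\<close>, and composition singles out
  one predecessor \<open>j\<close> on which \<open>i\<close> depends. An edge from a predecessor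
  respects the order and so closes no cycle.\<close>

lemma not_includes_dependent:
  fixes G :: "'v::finite graph"
  assumes comp: "composition_property p" and acyc: "acyclic G" and "\<not> dag_includes G p"
  obtains j i where "(j, i) \<notin> G" "acyclic (insert (j, i) G)"
    "\<not> cond_indep p {j} {i} (parents G i)"
proof -
  obtain r where r: "topo r G" using acyclic_ex_topo acyc .
  obtain i where "\<not> screens p (parents G i) (preds r i) i"
    using screens_dag_includes[OF r] assms(3) by blast
  then have "\<not> cond_indep p {i} (preds r i - parents G i) (parents G i)"
    using cond_indep_screens[OF parents_subset_preds[OF r]] by metis
  moreover have "i \<notin> preds r i - parents G i" "i \<notin> parents G i"
    using not_in_preds[of i r] parents_subset_preds[OF r, of i] by auto
  moreover have "(preds r i - parents G i) \<inter> parents G i = {}" by blast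
  ultimately have "\<exists>j\<in>preds r i - parents G i. \<not> cond_indep p {i} {j} (parents G i)"
    by (intro comp[unfolded composition_property_def, rule_format])
  then obtain j where j: "j \<in> preds r i - parents G i"
    and dep: "\<not> cond_indep p {i} {j} (parents G i)" by blast
  have "topo r (insert (j, i) G)"
    using r j unfolding topo_def preds_def by blast
  then have "acyclic (insert (j, i) G)" by (rule acyclic_topo)
  moreover have "(j, i) \<notin> G" using j by (simp add: parents_def)
  moreover have "\<not> cond_indep p {j} {i} (parents G i)"
    using dep cond_indep_sym by blast
  ultimately show thesis using that by blast
qed

section \<open>Both search phases on a data set with all score comparisons correct\<close>

locale consistent_on =
  fixes p :: "('v::finite \<Rightarrow> 's) pmf" and S :: "('v, 's) score" and D :: "('v \<Rightarrow> 's) list"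
  assumes composition: "composition_property p"
    and equivalent: "acyclic G \<Longrightarrow> acyclic H \<Longrightarrow> dag_equiv G H \<Longrightarrow> S G D = S H D"
    and dependent: "(j, i) \<notin> G \<Longrightarrow> acyclic (insert (j, i) G) \<Longrightarrow>
      \<not> cond_indep p {j} {i} (parents G i) \<Longrightarrow> S G D < S (insert (j, i) G) D"
    and independent: "(j, i) \<notin> G \<Longrightarrow> acyclic (insert (j, i) G) \<Longrightarrow>
      cond_indep p {j} {i} (parents G i) \<Longrightarrow> S (insert (j, i) G) D < S G D"
begin

lemma class_score_eq:
  assumes "E \<in> dag_classes" "G \<in> E"
  shows "class_score S D E = S G D"
proof -
  have "S H D = S G D" if H: "H \<in> E" for H
    by (rule equivalent[OF dag_classesD(1)[OF assms(1) H] dag_classesD(1)[OF assms]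
        class_members_equiv[OF assms(1) H assms(2)]])
  then have "(\<lambda>G. S G D) ` E = (\<lambda>_. S G D) ` E" by (rule image_cong[OF refl])
  also have "\<dots> = {S G D}" using assms(2) by blast
  finally show ?thesis by (simp add: class_score_def)
qed

lemma forward_local_maximum_includes:
  assumes E: "E \<in> dag_classes" "G \<in> E" and max: "local_maximum forward_move (class_score S D) E"
  shows "dag_includes G p"
proof (rule ccontr)
  assume "\<not> dag_includes G p"
  moreover have acyc: "acyclic G" using E by (rule dag_classesD)
  ultimately obtain j i where ji: "(j, i) \<notin> G" "acyclic (insert (j, i) G)"
    and dep: "\<not> cond_indep p {j} {i} (parents G i)"
    using not_includes_dependent[OF composition] by metis
  let ?F = "dag_class (insert (j, i) G)"
  have F: "?F \<in> dag_classes" "insert (j, i) G \<in> ?F"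
    using ji dag_class_in_dag_classes dag_equiv_refl by (auto simp: mem_dag_class)
  have "dag_le G (insert (j, i) G)"
    by (rule edge_op_dag_le[OF edge_op.add[OF ji]])
  moreover have "card (insert (j, i) G) = card G + 1" using ji(1) by simp
  ultimately have "forward_move E ?F"
    unfolding forward_move_def adjacent_classes_def class_le_def
    using E F by blast
  moreover have "class_score S D E < class_score S D ?F"
    using class_score_eq[OF E] class_score_eq[OF F] dependent[OF ji dep] by simp
  ultimately show False using max by (auto simp: local_maximum_def)
qed

text \<open>Up to equivalence the move deletes the last added edge of a chain. By contraposition of
  \<open>dependent\<close>, a gain in score means that its endpoints are independent given the
  remaining parents, so the deletion keeps \<open>p\<close> included.\<close>

lemma backward_move_includes:
  assumes move: "backward_move E F" and score: "class_score S D E < class_score S D F"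
    and inc: "\<And>G. G \<in> E \<Longrightarrow> dag_includes G p" and H': "H' \<in> F"
  shows "dag_includes H' p"
proof -
  obtain G H where E: "E \<in> dag_classes" "G \<in> E" and F: "F \<in> dag_classes" "H \<in> F"
    and le: "dag_le H G" and card: "card H = card G + 1 \<or> card G = card H + 1"
    using move unfolding backward_move_def adjacent_classes_def class_le_def by blast
  have acyc: "acyclic G" "acyclic H" using E F by (auto dest: dag_classesD)
  have "card G = Suc (card H)" using card dag_le_card_eq(1)[OF acyc(2,1) le] by linarith
  then obtain K j i where K: "dag_le H K" "acyclic K" "(j, i) \<notin> K" "acyclic (insert (j, i) K)"
    and KG: "dag_equiv (insert (j, i) K) G" and "card G = Suc (card K)"
    using dag_le_last_add[OF acyc(2,1) le] by (metis lessI)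
  then have HK: "dag_equiv H K"
    using dag_le_card_eq(2)[OF acyc(2) K(2,1)] \<open>card G = Suc (card H)\<close> by simp
  have "S (insert (j, i) K) D < S K D"
    using score class_score_eq[OF E] class_score_eq[OF F] equivalent[OF K(4) acyc(1) KG]
      equivalent[OF acyc(2) K(2) HK] by simp
  then have "cond_indep p {j} {i} (parents K i)"
    using dependent[OF K(3,4)] by fastforce
  moreover have "dag_includes (insert (j, i) K) p"
    using dag_le_includes[OF acyc(1) K(4)] KG inc[OF E(2)] by (simp add: dag_equiv_def)
  ultimately have "dag_includes K p"
    using dag_includes_delete[OF K(4,3)] by blast
  moreover have "dag_equiv K H'"
    using dag_equiv_trans[OF dag_equiv_sym[OF HK] class_members_equiv[OF F H']] .
  ultimately show ?thesis
    using dag_le_includes[OF K(2) dag_classesD(1)[OF F(1) H']] by (simp add: dag_equiv_def)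
qed

text \<open>Between a strictly smaller model that includes \<open>p\<close> and \<open>G\<close>
  there is a \<open>K\<close> one edge below \<open>G\<close>. It includes \<open>p\<close>, so its
  missing edge is an independence, and \<open>K\<close> is a better-scoring backward
  neighbour.\<close>

lemma backward_local_maximum_optimal:
  assumes E: "E \<in> dag_classes" "G \<in> E" and max: "local_maximum backward_move (class_score S D) E"
    and inc: "dag_includes G p"
  shows "inclusion_optimal p G"
  unfolding inclusion_optimal_def
proof (intro conjI notI)
  show "dag_includes G p" by (rule inc)
  assume "\<exists>G'. acyclic G' \<and> dag_less G' G \<and> dag_includes G' p"
  then obtain G' where G': "acyclic G'" "dag_le G' G" "\<not> dag_equiv G' G" "dag_includes G' p"
    by (auto simp: dag_less_def)
  have acyc: "acyclic G" using E by (rule dag_classesD)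
  have "card G' < card G"
    using dag_le_card_eq[OF G'(1) acyc G'(2)] G'(3) by fastforce
  then obtain K j i where K: "dag_le G' K" "acyclic K" "(j, i) \<notin> K" "acyclic (insert (j, i) K)"
    and KG: "dag_equiv (insert (j, i) K) G" and card: "card G = Suc (card K)"
    using dag_le_last_add[OF G'(1) acyc G'(2)] by metis
  have "dag_includes K p" by (rule dag_le_includes[OF G'(1) K(2,1) G'(4)])
  then have "cond_indep p {j} {i} (parents K i)"
    by (rule dag_includes_missing_edge[OF K(4,3)])
  then have "S (insert (j, i) K) D < S K D" by (rule independent[OF K(3,4)])
  moreover have F: "dag_class K \<in> dag_classes" "K \<in> dag_class K"
    using K(2) dag_class_in_dag_classes dag_equiv_refl by (auto simp: mem_dag_class)
  ultimately have "class_score S D E < class_score S D (dag_class K)"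
    using class_score_eq[OF E] class_score_eq[OF F] equivalent[OF K(4) acyc KG] by simp
  moreover have "backward_move E (dag_class K)"
    unfolding backward_move_def adjacent_classes_def
  proof (intro conjI)
    have "dag_le K G"
      using dag_le_trans[OF edge_op_dag_le[OF edge_op.add[OF K(3,4)]]] KG
      by (simp add: dag_equiv_def)
    with E F card show "\<exists>G\<in>E. \<exists>H\<in>dag_class K. (dag_le G H \<or> dag_le H G) \<and>
        (card H = card G + 1 \<or> card G = card H + 1)"
      by (intro bexI[of _ G] bexI[of _ K]) simp_all
    \<comment> \<open>Edge counts are constant on classes and cannot decrease under
      inclusion.\<close>
    show "\<not> class_le E (dag_class K)"
    proof
      assume "class_le E (dag_class K)"
      then obtain A B where A: "A \<in> E" and B: "B \<in> dag_class K" and "dag_le A B"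
        by (auto simp: class_le_def)
      then have "card A \<le> card B"
        by (intro dag_le_card_eq(1) dag_classesD(1)[OF E(1) A] dag_classesD(1)[OF F(1) B])
      moreover have "card A = card G"
        by (rule dag_equiv_card[OF dag_classesD(1)[OF E(1) A] acyc class_members_equiv[OF E(1) A E(2)]])
      moreover have "card B = card K"
        by (rule dag_equiv_card[OF dag_classesD(1)[OF F(1) B] K(2) class_members_equiv[OF F(1) B F(2)]])
      ultimately show False using card by simp
    qed
  qed (use E F in auto)
  ultimately show False using max by (auto simp: local_maximum_def)
qed

theorem GES_outputs_optimal:
  "GES_outputs S D \<noteq> {} \<and> (\<forall>E \<in> GES_outputs S D. class_inclusion_optimal p E)"
proof
  let ?sc = "class_score S D"
  obtain E where "greedy_search forward_move ?sc (dag_class {}) E"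
    using ex_greedy_search by blast
  moreover obtain F where "greedy_search backward_move ?sc E F"
    using ex_greedy_search by blast
  ultimately show "GES_outputs S D \<noteq> {}"
    unfolding GES_outputs_def by blast
  show "\<forall>F \<in> GES_outputs S D. class_inclusion_optimal p F"
  proof
    fix F assume "F \<in> GES_outputs S D"
    then obtain E where fes: "greedy_search forward_move ?sc (dag_class {}) E"
      and bes: "greedy_search backward_move ?sc E F"
      by (auto simp: GES_outputs_def)
    have "acyclic ({} :: 'v graph)" by (simp add: acyclic_def)
    then have "dag_class ({} :: 'v graph) \<in> dag_classes"
      by (rule dag_class_in_dag_classes)
    with fes have E: "E \<in> dag_classes"
      by (rule greedy_search_invariant) (simp add: forward_move_def adjacent_classes_def)
    have max: "local_maximum forward_move ?sc E" using fes by (simp add: greedy_search_def)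
    have "F \<in> dag_classes \<and> (\<forall>G\<in>F. dag_includes G p)"
      using bes
    proof (rule greedy_search_invariant)
      show "E \<in> dag_classes \<and> (\<forall>G\<in>E. dag_includes G p)"
        using E forward_local_maximum_includes[OF E _ max] by blast
      show "B \<in> dag_classes \<and> (\<forall>G\<in>B. dag_includes G p)"
        if "A \<in> dag_classes \<and> (\<forall>G\<in>A. dag_includes G p)" "backward_move A B" "?sc A < ?sc B" for A B
        using backward_move_includes[OF that(2,3)] that
        by (auto simp: backward_move_def adjacent_classes_def)
    qed
    moreover have "local_maximum backward_move ?sc F" using bes by (simp add: greedy_search_def)
    ultimately show "class_inclusion_optimal p F"
      unfolding class_inclusion_optimal_def using backward_local_maximum_optimal by blast
  qed
qed

end

section \<open>The large-sample limit\<close>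

lemma holds_in_limit_squeeze:
  assumes "f \<longlonglongrightarrow> 1" "\<And>m. f m \<le> \<P>(D in measure_pmf (replicate_pmf m p). P D)"
  shows "holds_in_limit p P"
  unfolding holds_in_limit_def
  by (rule tendsto_sandwich[OF _ _ assms(1) tendsto_const]) (use assms(2) in auto)

text \<open>Samples lie in the support almost surely, so the implication is required only for such
  data.\<close>

lemma holds_in_limit_mono:
  assumes P: "holds_in_limit p P" and "\<And>D. set D \<subseteq> set_pmf p \<Longrightarrow> P D \<Longrightarrow> Q D"
  shows "holds_in_limit p Q"
proof (rule holds_in_limit_squeeze[OF P[unfolded holds_in_limit_def]])
  fix m
  show "\<P>(D in measure_pmf (replicate_pmf m p). P D) \<le> \<P>(D in measure_pmf (replicate_pmf m p). Q D)"
    by (rule measure_pmf.finite_measure_mono_AE)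
      (use assms(2) in \<open>auto simp: AE_measure_pmf_iff set_replicate_pmf\<close>)
qed

text \<open>Squeezed from below by \<open>P(A and B) \<ge> P(A) + P(B) - 1\<close>.\<close>

lemma holds_in_limit_conj:
  assumes "holds_in_limit p P" "holds_in_limit p Q"
  shows "holds_in_limit p (\<lambda>D. P D \<and> Q D)"
proof (rule holds_in_limit_squeeze)
  let ?P = "\<lambda>m P. \<P>(D in measure_pmf (replicate_pmf m p). P D)"
  show "(\<lambda>m. ?P m P + ?P m Q - 1) \<longlonglongrightarrow> 1"
    using tendsto_diff[OF tendsto_add[OF assms[unfolded holds_in_limit_def]] tendsto_const, of 1]
    by simp
  fix m
  let ?M = "measure_pmf (replicate_pmf m p)"
  have "measure ?M ({D. P D} \<union> {D. Q D}) = measure ?M {D. P D} + measure ?M {D. Q D}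
      - measure ?M ({D. P D} \<inter> {D. Q D})"
    by (rule measure_pmf.finite_measure_Union'[THEN trans])
      (auto simp: measure_pmf.finite_measure_Diff' Int_commute)
  moreover have "measure ?M ({D. P D} \<union> {D. Q D}) \<le> 1" by simp
  ultimately show "?P m P + ?P m Q - 1 \<le> ?P m (\<lambda>D. P D \<and> Q D)"
    by (simp add: Int_def)
qed

lemma holds_in_limit_ball:
  assumes "finite I" "\<And>i. i \<in> I \<Longrightarrow> holds_in_limit p (P i)"
  shows "holds_in_limit p (\<lambda>D. \<forall>i\<in>I. P i D)"
  using assms
proof (induction I rule: finite_induct)
  case empty
  show ?case by (simp add: holds_in_limit_def)
next
  case (insert i I)
  then show ?case
    using holds_in_limit_conj[of p "P i" "\<lambda>D. \<forall>i\<in>I. P i D"] by simp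
qed

theorem theorem4:
  fixes St :: "'v::finite \<Rightarrow> 's set"
    and p :: "('v \<Rightarrow> 's) pmf"
    and S :: "('v, 's) score"
  assumes "finite_states St"
    and "distribution_on St p"
    and "composition_property p"
    and "locally_consistent St S"
    and "score_equivalent St S"
  shows "holds_in_limit p (\<lambda>D. GES_outputs S D \<noteq> {} \<and>
           (\<forall>E \<in> GES_outputs S D. class_inclusion_optimal p E))"
proof -
  \<comment> \<open>One instance of local consistency, vacuously true when the edge cannot be added;
    thus all triples can be quantified over, and their type is finite.\<close>
  define good where "good D = (\<lambda>(G, j, i). (j, i) \<notin> G \<longrightarrow> acyclic (insert (j, i) G) \<longrightarrow>
    (if cond_indep p {j} {i} (parents G i) then S (insert (j, i) G) D < S G D
     else S G D < S (insert (j, i) G) D))" for D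
  have "holds_in_limit p (\<lambda>D. good D t)" for t
  proof (cases t)
    case (fields G j i)
    show ?thesis
    proof (cases "(j, i) \<notin> G \<and> acyclic (insert (j, i) G)")
      case True
      then have "acyclic G" using acyclic_subset by blast
      with True have "(\<not> cond_indep p {j} {i} (parents G i) \<longrightarrow>
            holds_in_limit p (\<lambda>D. S G D < S (insert (j, i) G) D)) \<and>
          (cond_indep p {j} {i} (parents G i) \<longrightarrow>
            holds_in_limit p (\<lambda>D. S (insert (j, i) G) D < S G D))"
        using assms(2,4) unfolding locally_consistent_def by blast
      with True show ?thesis
        by (cases "cond_indep p {j} {i} (parents G i)") (simp_all add: fields good_def)
    next
      case False
      then show ?thesis by (auto simp: holds_in_limit_def fields good_def)
    qed
  qed
  then have "holds_in_limit p (\<lambda>D. \<forall>t\<in>UNIV. good D t)"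
    by (intro holds_in_limit_ball) auto
  then show ?thesis
  proof (rule holds_in_limit_mono)
    fix D assume D: "set D \<subseteq> set_pmf p" and good: "\<forall>t\<in>UNIV. good D t"
    \<comment> \<open>Score equivalence is given for data over the state spaces, and samples from
      \<open>p\<close> are such data.\<close>
    have "set D \<subseteq> configs St" using D assms(2) by (auto simp: distribution_on_def)
    then interpret consistent_on p S D
      using assms(3,5) good
      by unfold_locales (auto simp: score_equivalent_def good_def split: if_splits)
    show "GES_outputs S D \<noteq> {} \<and> (\<forall>E \<in> GES_outputs S D. class_inclusion_optimal p E)"
      by (rule GES_outputs_optimal)
  qed
qed

end
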